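(* Let $(\tau,s)\in\mathcal{D}$ and let $\{\mathbf{w}^k\}$ and $\{\widetilde{\mathbf{w}}^k\}$ be generated by GS-ADMM. For any integer $t>0$, there exists a constant $\theta>0$ such that $$\left\|\mathbf{d}^t\right\|^2\le\frac{\theta}{t+1}\qquad\text{and}\qquad\left\|\mathcal{A}\widetilde{\mathbf{x}}^t+\mathcal{B}\widetilde{\mathbf{y}}^t-c\right\|^2\le\frac{\theta}{t+1},$$ where $\mathbf{d}^t=(\mathbf{d}_{11}^t,\dots,\mathbf{d}_{1p}^t,\mathbf{d}_{21}^t,\dots,\mathbf{d}_{2q}^t)$ is defined componentwise by $$\mathbf{d}_{1i}^t=-\beta A_i^{\sf T}\sum_{l=1,\,l\neq i}^p A_l(\widetilde{x}_l^t-x_l^t)+\sigma_1\beta A_i^{\sf T}\sum_{l=1}^p A_l(\widetilde{x}_l^t-x_l^t),\quad i=1,\dots,p,$$ $$\mathbf{d}_{2j}^t=(\sigma_2+1)\beta B_j^{\sf T}B_j(\widetilde{y}_j^{t}-y_j^t)-\tau B_j^{\sf T}(\widetilde{\lambda}^t-\lambda^t),\quad j=1,\dots,q,$$ and satisfies $$A_i^{\sf T}\widetilde{\lambda}^t-\mathbf{d}_{1i}^t\in\partial f_i(\widetilde{x}_i^t)+\mathcal{N}_{\mathcal{X}_i}(\widetilde{x}_i^t)\ (i=1,\dots,p),\qquad B_j^{\sf T}\widetilde{\lambda}^t-\mathbf{d}_{2j}^t\in\partial g_j(\widetilde{y}_j^t)+\mathcal{N}_{\mathcal{Y}_j}(\widetilde{y}_j^t)\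 (j=1,\dots,q),$$ and $\theta$ depends on the problem data and the parameters of GS-ADMM.
   Context: Problem. Let $p,q\ge 1$ be integers. Consider $$\min \sum_{i=1}^{p}f_i(x_i)+ \sum_{j=1}^{q}g_j(y_j)\quad \text{s.t. } \sum_{i=1}^{p}A_i x_i+\sum_{j=1}^{q}B_jy_j=c,\ x_i\in \mathcal{X}_i\ (i=1,\dots,p),\ y_j\in \mathcal{Y}_j\ (j=1,\dots,q),$$ where $f_i:\mathbb{R}^{m_i}\to\mathbb{R}$, $g_j:\mathbb{R}^{d_j}\to\mathbb{R}$ are closed proper convex functions (possibly nonsmooth), $A_i\in\mathbb{R}^{n\times m_i}$, $B_j\in\mathbb{R}^{n\times d_j}$, $c\in\mathbb{R}^n$, and $\mathcal{X}_i\subset\mathbb{R}^{m_i}$, $\mathcal{Y}_j\subset\mathbb{R}^{d_j}$ are polyhedra. Standing assumptions: the solution set of this problem is nonempty and all $A_i$, $B_j$ have full column rank. Notation. $\mathcal{A}=[A_1,\dots,A_p]$, $\mathcal{B}=[B_1,\dots,B_q]$, $\mathbf{x}=(x_1,\dots,x_p)$, $\mathbf{y}=(y_1,\dots,y_q)$, $\mathbf{w}=(\mathbf{x},\mathbf{y},\lambda)$ with $\lambda\in\mathbb{R}^n$. $\|\cdot\|$ is the Euclidean norm, $\partial f$ is the convex subdifferential, and $\mathcal{N}_{\mathcal{X}}(x)$ is the normal cone of $\mathcal{X}$ at $x$. For $\beta>0$, $$\mathcal{L}_\beta(\mathbf{x},\mathbf{y},\lambda)=\sum_{i=1}^p f_i(x_i)+\sum_{j=1}^q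 g_j(y_j)-\langle\lambda,\mathcal{A}\mathbf{x}+\mathcal{B}\mathbf{y}-c\rangle+\frac{\beta}{2}\|\mathcal{A}\mathbf{x}+\mathcal{B}\mathbf{y}-c\|^2 .$$ GS-ADMM. Parameters: $\beta>0$, $\sigma_1\in(p-1,+\infty)$, $\sigma_2\in(q-1,+\infty)$, and stepsizes $(\tau,s)\in\mathcal{D}:=\{(\tau,s)\mid \tau<1,\ s<1,\ \tau+s>0\}$. From an initial point $\mathbf{w}^0=(\mathbf{x}^0,\mathbf{y}^0,\lambda^0)$, for $k=0,1,2,\dots$: - $x_i^{k+1}=\arg\min_{x_i\in\mathcal{X}_i}\mathcal{L}_\beta(x_1^k,\dots,x_i,\dots,x_p^k,\mathbf{y}^k,\lambda^k)+\frac{\sigma_1\beta}{2}\|A_i(x_i-x_i^k)\|^2$, for $i=1,\dots,p$; - $\lambda^{k+\frac12}=\lambda^k-\tau\beta(\mathcal{A}\mathbf{x}^{k+1}+\mathcal{B}\mathbf{y}^k-c)$; - $y_j^{k+1}=\arg\min_{y_j\in\mathcal{Y}_j}\mathcal{L}_\beta(\mathbf{x}^{k+1},y_1^k,\dots,y_j,\dots,y_q^k,\lambda^{k+\frac12})+\frac{\sigma_2\beta}{2}\|B_j(y_j-y_j^k)\|^2$, for $j=1,\dots,q$; - $\lambda^{k+1}=\lambda^{k+\frac12}-s\beta(\mathcal{A}\mathbf{x}^{k+1}+\mathcal{B}\mathbf{y}^{k+1}-c)$. Put $\mathbf{w}^k=(\mathbf{x}^k,\mathbf{y}^k,\lambda^k)$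 and $\widetilde{\mathbf{w}}^k=(\widetilde{\mathbf{x}}^k,\widetilde{\mathbf{y}}^k,\widetilde\lambda^k)$ with $\widetilde{\mathbf{x}}^k=(\widetilde x_1^k,\dots,\widetilde x_p^k)=\mathbf{x}^{k+1}$, $\widetilde{\mathbf{y}}^k=(\widetilde y_1^k,\dots,\widetilde y_q^k)=\mathbf{y}^{k+1}$, $\widetilde\lambda^k=\lambda^k-\beta(\mathcal{A}\mathbf{x}^{k+1}+\mathcal{B}\mathbf{y}^k-c)$.
   Formalization: The inclusion for f_i fails for p≥2 with the printed d_{1i}; it is proved with proximal term σ₁βA_iᵀA_i(x̃_i−x_i) instead of the sum over l. The rate is proved for both the corrected and the printed d. θ is uniform in t but may depend on the initial point w⁰. *)

theory Defs
  imports "HOL-Analysis.Analysis"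
begin

text \<open>
  The block spaces \<open>\<real>\<^sup>m\<close> have dimensions that vary with the block. The space of block \<open>i\<close> is
  represented as the coordinate subspace of one ambient space \<^typ>\<open>real ^ 'm\<close> belonging to an
  arbitrary set \<open>I i\<close> of coordinates, so its dimension is the cardinality of \<open>I i\<close>; since \<open>'m\<close>
  and \<open>I\<close> are arbitrary, every finite family of dimensions occurs. A matrix with \<open>card (I i)\<close>
  columns is a matrix over the ambient index type whose columns outside \<open>I i\<close> vanish. A family
  of blocks is a function on \<^typ>\<open>nat\<close>, of which only the values at \<open>1, ..., p\<close> are used.
\<close>

definition coord_space :: "'m set \<Rightarrow> (real ^ 'm) set" where
  "coord_space I = {x. \<forall>k. k \<notin> I \<longrightarrow> x $ k = 0}"

definition columns_in :: "'m set \<Rightarrow> real ^ 'm ^ 'n \<Rightarrow> bool" where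
  "columns_in I A \<longleftrightarrow> (\<forall>k. k \<notin> I \<longrightarrow> column k A = 0)"

lemma dim_coord_space: "dim (coord_space I) = card I"
  unfolding coord_space_def using dim_substandard_cart[of I, where 'a = real]
  by (simp add: dim_vec_eq)

lemma transpose_mult_in_coord_space:
  "columns_in I A \<Longrightarrow> transpose A *v v \<in> coord_space I"
  by (simp add: columns_in_def coord_space_def matrix_vector_mult_def transpose_def
      column_def vec_eq_iff)

text \<open>Properness is automatic, because the functions are real-valued.\<close>

definition closed_convex_fun :: "'a::real_normed_vector set \<Rightarrow> ('a \<Rightarrow> real) \<Rightarrow> bool" where
  "closed_convex_fun V f \<longleftrightarrow> convex_on V f \<and> closed (epigraph V f)"

text \<open>
  Subdifferential and normal cone are taken inside the space \<open>V\<close> on which the function lives,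
  not in the ambient space.
\<close>

definition subdifferential :: "'a::real_inner set \<Rightarrow> ('a \<Rightarrow> real) \<Rightarrow> 'a \<Rightarrow> 'a set" where
  "subdifferential V f x = {v \<in> V. \<forall>z\<in>V. f x + v \<bullet> (z - x) \<le> f z}"

definition normal_cone :: "'a::real_inner set \<Rightarrow> 'a set \<Rightarrow> 'a \<Rightarrow> 'a set" where
  "normal_cone V S x = {v \<in> V. x \<in> S \<and> (\<forall>z\<in>S. v \<bullet> (z - x) \<le> 0)}"

definition objective ::
  "nat \<Rightarrow> nat \<Rightarrow> (nat \<Rightarrow> 'a \<Rightarrow> real) \<Rightarrow> (nat \<Rightarrow> 'b \<Rightarrow> real) \<Rightarrow> (nat \<Rightarrow> 'a) \<Rightarrow> (nat \<Rightarrow> 'b) \<Rightarrow> real" where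
  "objective p q f g x y = (\<Sum>i=1..p. f i (x i)) + (\<Sum>j=1..q. g j (y j))"

text \<open>The residual \<open>\<A>x + \<B>y - c\<close>.\<close>

definition residual ::
  "nat \<Rightarrow> nat \<Rightarrow> (nat \<Rightarrow> real ^ 'm ^ 'n) \<Rightarrow> (nat \<Rightarrow> real ^ 'd ^ 'n) \<Rightarrow> real ^ 'n \<Rightarrow>
   (nat \<Rightarrow> real ^ 'm) \<Rightarrow> (nat \<Rightarrow> real ^ 'd) \<Rightarrow> real ^ 'n" where
  "residual p q A B c x y = (\<Sum>i=1..p. A i *v x i) + (\<Sum>j=1..q. B j *v y j) - c"

definition feasible ::
  "nat \<Rightarrow> nat \<Rightarrow> (nat \<Rightarrow> real ^ 'm ^ 'n) \<Rightarrow> (nat \<Rightarrow> real ^ 'd ^ 'n) \<Rightarrow> real ^ 'n \<Rightarrow>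
   (nat \<Rightarrow> (real ^ 'm) set) \<Rightarrow> (nat \<Rightarrow> (real ^ 'd) set) \<Rightarrow>
   (nat \<Rightarrow> real ^ 'm) \<Rightarrow> (nat \<Rightarrow> real ^ 'd) \<Rightarrow> bool" where
  "feasible p q A B c X Y x y \<longleftrightarrow>
     (\<Sum>i=1..p. A i *v x i) + (\<Sum>j=1..q. B j *v y j) = c \<and>
     (\<forall>i\<in>{1..p}. x i \<in> X i) \<and> (\<forall>j\<in>{1..q}. y j \<in> Y j)"

definition solution_set ::
  "nat \<Rightarrow> nat \<Rightarrow> (nat \<Rightarrow> real ^ 'm \<Rightarrow> real) \<Rightarrow> (nat \<Rightarrow> real ^ 'd \<Rightarrow> real) \<Rightarrow>
   (nat \<Rightarrow> real ^ 'm ^ 'n) \<Rightarrow> (nat \<Rightarrow> real ^ 'd ^ 'n) \<Rightarrow> real ^ 'n \<Rightarrow>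
   (nat \<Rightarrow> (real ^ 'm) set) \<Rightarrow> (nat \<Rightarrow> (real ^ 'd) set) \<Rightarrow>
   ((nat \<Rightarrow> real ^ 'm) \<times> (nat \<Rightarrow> real ^ 'd)) set" where
  "solution_set p q f g A B c X Y =
     {(x, y). feasible p q A B c X Y x y \<and>
        (\<forall>x' y'. feasible p q A B c X Y x' y' \<longrightarrow> objective p q f g x y \<le> objective p q f g x' y')}"

definition aug_lagrangian ::
  "nat \<Rightarrow> nat \<Rightarrow> (nat \<Rightarrow> real ^ 'm \<Rightarrow> real) \<Rightarrow> (nat \<Rightarrow> real ^ 'd \<Rightarrow> real) \<Rightarrow>
   (nat \<Rightarrow> real ^ 'm ^ 'n) \<Rightarrow> (nat \<Rightarrow> real ^ 'd ^ 'n) \<Rightarrow> real ^ 'n \<Rightarrow> real \<Rightarrow>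
   (nat \<Rightarrow> real ^ 'm) \<Rightarrow> (nat \<Rightarrow> real ^ 'd) \<Rightarrow> real ^ 'n \<Rightarrow> real" where
  "aug_lagrangian p q f g A B c \<beta> x y lam =
     objective p q f g x y - lam \<bullet> residual p q A B c x y
     + \<beta> / 2 * (norm (residual p q A B c x y))\<^sup>2"

definition step_region :: "(real \<times> real) set" where
  "step_region = {(\<tau>, s). \<tau> < 1 \<and> s < 1 \<and> \<tau> + s > 0}"

text \<open>The intermediate multiplier, with index \<open>k + 1/2\<close>.\<close>

definition half_multiplier ::
  "nat \<Rightarrow> nat \<Rightarrow> (nat \<Rightarrow> real ^ 'm ^ 'n) \<Rightarrow> (nat \<Rightarrow> real ^ 'd ^ 'n) \<Rightarrow> real ^ 'n \<Rightarrow> real \<Rightarrow> real \<Rightarrow>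
   (nat \<Rightarrow> nat \<Rightarrow> real ^ 'm) \<Rightarrow> (nat \<Rightarrow> nat \<Rightarrow> real ^ 'd) \<Rightarrow> (nat \<Rightarrow> real ^ 'n) \<Rightarrow> nat \<Rightarrow> real ^ 'n" where
  "half_multiplier p q A B c \<beta> \<tau> x y lam k =
     lam k - (\<tau> * \<beta>) *\<^sub>R residual p q A B c (x (Suc k)) (y k)"

text \<open>
  \<open>x k i\<close> is block \<open>i\<close> of iterate \<open>k\<close>. All blocks of a group are updated from iterate \<open>k\<close>
  (Jacobi fashion), which is why the minimisation variable is substituted into \<open>x k\<close> and \<open>y k\<close>.
\<close>

definition gs_admm ::
  "nat \<Rightarrow> nat \<Rightarrow> (nat \<Rightarrow> real ^ 'm \<Rightarrow> real) \<Rightarrow> (nat \<Rightarrow> real ^ 'd \<Rightarrow> real) \<Rightarrow>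
   (nat \<Rightarrow> real ^ 'm ^ 'n) \<Rightarrow> (nat \<Rightarrow> real ^ 'd ^ 'n) \<Rightarrow> real ^ 'n \<Rightarrow>
   (nat \<Rightarrow> (real ^ 'm) set) \<Rightarrow> (nat \<Rightarrow> (real ^ 'd) set) \<Rightarrow>
   real \<Rightarrow> real \<Rightarrow> real \<Rightarrow> real \<Rightarrow> real \<Rightarrow>
   (nat \<Rightarrow> nat \<Rightarrow> real ^ 'm) \<Rightarrow> (nat \<Rightarrow> nat \<Rightarrow> real ^ 'd) \<Rightarrow> (nat \<Rightarrow> real ^ 'n) \<Rightarrow> bool" where
  "gs_admm p q f g A B c X Y \<beta> \<sigma>1 \<sigma>2 \<tau> s x y lam \<longleftrightarrow>
     (\<forall>k.
       (\<forall>i\<in>{1..p}. is_arg_min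
          (\<lambda>u. aug_lagrangian p q f g A B c \<beta> ((x k)(i := u)) (y k) (lam k)
                + \<sigma>1 * \<beta> / 2 * (norm (A i *v (u - x k i)))\<^sup>2)
          (\<lambda>u. u \<in> X i) (x (Suc k) i)) \<and>
       (\<forall>j\<in>{1..q}. is_arg_min
          (\<lambda>v. aug_lagrangian p q f g A B c \<beta> (x (Suc k)) ((y k)(j := v))
                  (half_multiplier p q A B c \<beta> \<tau> x y lam k)
                + \<sigma>2 * \<beta> / 2 * (norm (B j *v (v - y k j)))\<^sup>2)
          (\<lambda>v. v \<in> Y j) (y (Suc k) j)) \<and>
       lam (Suc k) = half_multiplier p q A B c \<beta> \<tau> x y lam k
          - (s * \<beta>) *\<^sub>R residual p q A B c (x (Suc k)) (y (Suc k)))"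

definition lam_tilde ::
  "nat \<Rightarrow> nat \<Rightarrow> (nat \<Rightarrow> real ^ 'm ^ 'n) \<Rightarrow> (nat \<Rightarrow> real ^ 'd ^ 'n) \<Rightarrow> real ^ 'n \<Rightarrow> real \<Rightarrow>
   (nat \<Rightarrow> nat \<Rightarrow> real ^ 'm) \<Rightarrow> (nat \<Rightarrow> nat \<Rightarrow> real ^ 'd) \<Rightarrow> (nat \<Rightarrow> real ^ 'n) \<Rightarrow> nat \<Rightarrow> real ^ 'n" where
  "lam_tilde p q A B c \<beta> x y lam k = lam k - \<beta> *\<^sub>R residual p q A B c (x (Suc k)) (y k)"

text \<open>
  In \<open>dual_res1\<close> the proximal term couples block \<open>i\<close> only with itself: this is what the
  optimality condition of the subproblem for block \<open>i\<close> yields, and hence what makes the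
  subdifferential inclusion true. In \<open>dual_res1_sum\<close> the proximal term is summed over all blocks.
  The two agree for \<open>p = 1\<close>; for \<open>p \<ge> 2\<close> the second one obeys the same norm bound, but the
  inclusion fails for it in general.
\<close>

definition dual_res1 ::
  "nat \<Rightarrow> (nat \<Rightarrow> real ^ 'm ^ 'n) \<Rightarrow> real \<Rightarrow> real \<Rightarrow>
   (nat \<Rightarrow> real ^ 'm) \<Rightarrow> (nat \<Rightarrow> real ^ 'm) \<Rightarrow> nat \<Rightarrow> real ^ 'm" where
  "dual_res1 p A \<beta> \<sigma>1 xt x i =
     - (\<beta> *\<^sub>R (transpose (A i) *v (\<Sum>l\<in>{1..p} - {i}. A l *v (xt l - x l))))
     + (\<sigma>1 * \<beta>) *\<^sub>R (transpose (A i) *v (A i *v (xt i - x i)))"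

definition dual_res1_sum ::
  "nat \<Rightarrow> (nat \<Rightarrow> real ^ 'm ^ 'n) \<Rightarrow> real \<Rightarrow> real \<Rightarrow>
   (nat \<Rightarrow> real ^ 'm) \<Rightarrow> (nat \<Rightarrow> real ^ 'm) \<Rightarrow> nat \<Rightarrow> real ^ 'm" where
  "dual_res1_sum p A \<beta> \<sigma>1 xt x i =
     - (\<beta> *\<^sub>R (transpose (A i) *v (\<Sum>l\<in>{1..p} - {i}. A l *v (xt l - x l))))
     + (\<sigma>1 * \<beta>) *\<^sub>R (transpose (A i) *v (\<Sum>l=1..p. A l *v (xt l - x l)))"

definition dual_res2 ::
  "(nat \<Rightarrow> real ^ 'd ^ 'n) \<Rightarrow> real \<Rightarrow> real \<Rightarrow> real \<Rightarrow>
   (nat \<Rightarrow> real ^ 'd) \<Rightarrow> (nat \<Rightarrow> real ^ 'd) \<Rightarrow> real ^ 'n \<Rightarrow> real ^ 'n \<Rightarrow> nat \<Rightarrow> real ^ 'd" where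
  "dual_res2 B \<beta> \<sigma>2 \<tau> yt y lamt lam j =
     ((\<sigma>2 + 1) * \<beta>) *\<^sub>R (transpose (B j) *v (B j *v (yt j - y j)))
     - \<tau> *\<^sub>R (transpose (B j) *v (lamt - lam))"

text \<open>Euclidean norm of the stacked vector \<open>(u\<^sub>1, ..., u\<^sub>p, v\<^sub>1, ..., v\<^sub>q)\<close>.\<close>

definition stacked_norm ::
  "nat \<Rightarrow> nat \<Rightarrow> (nat \<Rightarrow> 'a::real_normed_vector) \<Rightarrow> (nat \<Rightarrow> 'b::real_normed_vector) \<Rightarrow> real" where
  "stacked_norm p q u v = sqrt ((\<Sum>i=1..p. (norm (u i))\<^sup>2) + (\<Sum>j=1..q. (norm (v j))\<^sup>2))"

end

theory Submission
  imports Defs "HOL-Library.Function_Algebras"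
begin

text \<open>
  In the image variables \<open>A\<^sub>i x\<^sub>i\<close>, \<open>B\<^sub>j y\<^sub>j\<close> the iteration is a prediction-correction scheme
  \<open>w\<^sup>k\<^sup>+\<^sup>1 = w\<^sup>k - M e\<^sup>k\<close> with \<open>e\<^sup>k = w\<^sup>k - v\<^sup>k\<close>, \<open>v\<^sup>k\<close> the predicted point, at which the monotone
  optimality operator has the value \<open>Q e\<^sup>k\<close>. On the step region both \<open>H = Q M\<^sup>-\<^sup>1\<close> and
  \<open>G = Q + Q\<^sup>T - M\<^sup>T H M\<close> are positive definite, because \<open>\<sigma>\<^sub>1 + 1 > p\<close> and \<open>\<sigma>\<^sub>2 + 1 > q\<close>. Monotonicity
  against a saddle point makes \<open>\<Sum>\<^sub>k \<parallel>e\<^sup>k\<parallel>\<^sup>2\<close> (in the norm of \<open>G\<close>) at most the squared \<open>H\<close>-distance of \<open>w\<^sup>0\<close>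
  to it, and monotonicity between consecutive predictions makes \<open>\<parallel>M e\<^sup>k\<parallel>\<close> (in the norm of \<open>H\<close>)
  nonincreasing, so \<open>\<parallel>e\<^sup>t\<parallel>\<^sup>2 = O(1/t)\<close>; all residuals are linear in \<open>e\<^sup>t\<close>. The saddle point exists
  because the constraints are polyhedral and the objective functions are finite everywhere.
\<close>

section \<open>Linear images and sums of polyhedra\<close>

lemma polyhedron_inequalities:
  fixes S :: "'a::euclidean_space set"
  shows "polyhedron S \<longleftrightarrow> (\<exists>H. finite H \<and> S = {x. \<forall>(a, b)\<in>H. a \<bullet> x \<le> b})"
proof
  assume "polyhedron S"
  then obtain F where F: "finite F" "S = \<Inter>F" "\<forall>h\<in>F. \<exists>a b. a \<noteq> 0 \<and> h = {x. a \<bullet> x \<le> b}"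
    unfolding polyhedron_def by blast
  then obtain a b where ab: "\<And>h. h \<in> F \<Longrightarrow> h = {x. a h \<bullet> x \<le> b h}"
    by metis
  have "S = {x. \<forall>(a, b)\<in>(\<lambda>h. (a h, b h)) ` F. a \<bullet> x \<le> b}"
    using ab F(2) by auto
  then show "\<exists>H. finite H \<and> S = {x. \<forall>(a, b)\<in>H. a \<bullet> x \<le> b}"
    using F(1) by blast
next
  assume "\<exists>H. finite H \<and> S = {x. \<forall>(a, b)\<in>H. a \<bullet> x \<le> b}"
  then obtain H where H: "finite H" "S = {x. \<forall>(a, b)\<in>H. a \<bullet> x \<le> b}"
    by blast
  then have "S = \<Inter>((\<lambda>(a, b). {x. a \<bullet> x \<le> b}) ` H)"
    by auto
  moreover have "polyhedron (\<Inter>((\<lambda>(a, b). {x. a \<bullet> x \<le> b}) ` H))"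
    using H(1) by (intro polyhedron_Inter) (auto simp: polyhedron_halfspace_le)
  ultimately show "polyhedron S"
    by simp
qed

text \<open>The normal \<open>a\<close> of a half-space pulls back to \<open>adjoint T a\<close>,
  with the same right-hand side.\<close>

lemma polyhedron_linear_vimage:
  fixes T :: "'a::euclidean_space \<Rightarrow> 'b::euclidean_space"
  assumes "linear T" "polyhedron S"
  shows "polyhedron (T -` S)"
proof -
  obtain H where H: "finite H" "S = {x. \<forall>(a, b)\<in>H. a \<bullet> x \<le> b}"
    using assms(2) polyhedron_inequalities by blast
  have "T -` S = {x. \<forall>(a, b)\<in>(\<lambda>(a, b). (adjoint T a, b)) ` H. a \<bullet> x \<le> b}"
    unfolding H(2) by (auto simp: adjoint_clauses[OF assms(1)])
  then show ?thesis
    using H(1) unfolding polyhedron_inequalities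
    by (intro exI[of _ "(\<lambda>(a, b). (adjoint T a, b)) ` H"]) simp
qed

text \<open>Solvability in the eliminated variable: the largest lower bound serves, if there is
  one.\<close>

lemma real_between_finite_sets:
  fixes L U :: "real set"
  assumes "finite L" "finite U" "\<And>l u. l \<in> L \<Longrightarrow> u \<in> U \<Longrightarrow> l \<le> u"
  obtains s where "\<And>l. l \<in> L \<Longrightarrow> l \<le> s" "\<And>u. u \<in> U \<Longrightarrow> s \<le> u"
proof (cases "L = {}")
  case True
  show ?thesis
  proof (rule that)
    \<comment> \<open>Without lower bounds any number below all of \<open>U\<close> serves; the
      inserted 0 gives \<open>Min\<close> a nonempty set when \<open>U\<close> is empty.\<close>
    show "l \<le> Min (insert 0 U)" if "l \<in> L" for l
      using True that by simp
    show "Min (insert 0 U) \<le> u" if "u \<in> U" for u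
      using assms(2) that by simp
  qed
next
  case False
  then show ?thesis
    using that[of "Max L"] assms by auto
qed

text \<open>Fourier--Motzkin elimination of the direction \<open>d\<close>.\<close>

lemma polyhedron_plus_line:
  fixes S :: "'a::euclidean_space set"
  assumes "polyhedron S"
  shows "polyhedron {x. \<exists>r. x + r *\<^sub>R d \<in> S}"
proof -
  obtain H where H: "finite H" "S = {x. \<forall>(a, b)\<in>H. a \<bullet> x \<le> b}"
    using assms polyhedron_inequalities by blast
  \<comment> \<open>Along \<open>d\<close> an inequality in \<open>Z\<close> does not change, one in
    \<open>P\<close> bounds \<open>r\<close> from above, one in \<open>N\<close> from below.\<close>
  define Z P N where "Z = {h\<in>H. fst h \<bullet> d = 0}" and "P = {h\<in>H. fst h \<bullet> d > 0}"
    and "N = {h\<in>H. fst h \<bullet> d < 0}"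
  \<comment> \<open>The positive combination of an inequality from \<open>P\<close> and one from
    \<open>N\<close> in which the coefficients along \<open>d\<close> cancel.\<close>
  define mix where "mix = (\<lambda>(h, k). (- (fst k \<bullet> d)) *\<^sub>R h + (fst h \<bullet> d) *\<^sub>R (k :: 'a \<times> real))"
  have fin: "finite Z" "finite P" "finite N"
    using H(1) by (auto simp: Z_def P_def N_def)
  have mix: "fst (mix (h, k)) \<bullet> x \<le> snd (mix (h, k)) \<longleftrightarrow>
      (snd k - fst k \<bullet> x) / (fst k \<bullet> d) \<le> (snd h - fst h \<bullet> x) / (fst h \<bullet> d)"
    if "h \<in> P" "k \<in> N" for h k x
    using that by (simp add: mix_def P_def N_def inner_add_left inner_diff_left field_simps)
  have "(\<exists>r. x + r *\<^sub>R d \<in> S) \<longleftrightarrow> (\<forall>(a, b)\<in>Z \<union> mix ` (P \<times> N). a \<bullet> x \<le> b)" for x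
  proof
    assume "\<exists>r. x + r *\<^sub>R d \<in> S"
    then obtain r where "x + r *\<^sub>R d \<in> S"
      by blast
    then have r: "fst h \<bullet> x + r * (fst h \<bullet> d) \<le> snd h" if "h \<in> H" for h
      using that by (auto simp: H(2) inner_add_right)
    have "fst h \<bullet> x \<le> snd h" if "h \<in> Z" for h
      using r[of h] that by (auto simp: Z_def)
    moreover have "fst (mix (h, k)) \<bullet> x \<le> snd (mix (h, k))" if "h \<in> P" "k \<in> N" for h k
    proof -
      have "(snd k - fst k \<bullet> x) / (fst k \<bullet> d) \<le> r" "r \<le> (snd h - fst h \<bullet> x) / (fst h \<bullet> d)"
        using r[of h] r[of k] that by (auto simp: P_def N_def field_simps)
      then show ?thesis
        unfolding mix[OF that] by linarith
    qed
    ultimately have "fst h \<bullet> x \<le> snd h" if "h \<in> Z \<union> mix ` (P \<times> N)" for h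
      using that by blast
    then show "\<forall>(a, b)\<in>Z \<union> mix ` (P \<times> N). a \<bullet> x \<le> b"
      by (simp add: case_prod_beta)
  next
    assume *: "\<forall>(a, b)\<in>Z \<union> mix ` (P \<times> N). a \<bullet> x \<le> b"
    have Z: "fst h \<bullet> x \<le> snd h" if "h \<in> Z" for h
      using bspec[OF *, of h] that by (simp add: case_prod_beta)
    have PN: "fst (mix (h, k)) \<bullet> x \<le> snd (mix (h, k))" if "h \<in> P" "k \<in> N" for h k
    proof -
      have "mix (h, k) \<in> Z \<union> mix ` (P \<times> N)"
        using that by blast
      from bspec[OF * this] show ?thesis
        by (simp add: case_prod_beta)
    qed
    define f where "f = (\<lambda>h. (snd h - fst h \<bullet> x) / (fst h \<bullet> d))"
    have "l \<le> u" if "l \<in> f ` N" "u \<in> f ` P" for l u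
      using that PN mix by (auto simp: f_def)
    then obtain r where r: "\<And>l. l \<in> f ` N \<Longrightarrow> l \<le> r" "\<And>u. u \<in> f ` P \<Longrightarrow> r \<le> u"
      using real_between_finite_sets[of "f ` N" "f ` P"] fin(2,3) by blast
    have "fst h \<bullet> x + r * (fst h \<bullet> d) \<le> snd h" if h: "h \<in> H" for h
    proof -
      consider "h \<in> Z" | "h \<in> P" | "h \<in> N"
        using h by (force simp: Z_def P_def N_def)
      then show ?thesis
      proof cases
        case 1
        then show ?thesis
          using Z[of h] by (simp add: Z_def)
      next
        case 2
        then show ?thesis
          using r(2)[OF imageI, of h] by (simp add: f_def P_def field_simps)
      next
        case 3
        then show ?thesis
          using r(1)[OF imageI, of h] by (simp add: f_def N_def field_simps)
      qed
    qed
    then have "x + r *\<^sub>R d \<in> S"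
      by (auto simp: H(2) inner_add_right)
    then show "\<exists>r. x + r *\<^sub>R d \<in> S" ..
  qed
  then have "{x. \<exists>r. x + r *\<^sub>R d \<in> S} = {x. \<forall>(a, b)\<in>Z \<union> mix ` (P \<times> N). a \<bullet> x \<le> b}"
    by blast
  then show ?thesis
    using fin unfolding polyhedron_inequalities by (intro exI[of _ "Z \<union> mix ` (P \<times> N)"]) simp
qed

text \<open>One spanning vector is eliminated at a time.\<close>

lemma polyhedron_plus_span:
  fixes S :: "'a::euclidean_space set"
  assumes "finite D" "polyhedron S"
  shows "polyhedron {x. \<exists>v\<in>span D. x + v \<in> S}"
  using assms
proof (induction D rule: finite_induct)
  case empty
  then show ?case by simp
next
  case (insert d D)
  have "{x. \<exists>v\<in>span (insert d D). x + v \<in> S}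
      = {x. \<exists>r. x + r *\<^sub>R d \<in> {x. \<exists>v\<in>span D. x + v \<in> S}}"
    (is "?L = ?R")
  proof (intro equalityI subsetI)
    fix x assume "x \<in> ?L"
    then obtain v r where "v - r *\<^sub>R d \<in> span D" "x + v \<in> S"
      by (auto simp: span_insert)
    then show "x \<in> ?R"
      by (auto intro!: exI[of _ r] bexI[of _ "v - r *\<^sub>R d"])
  next
    fix x assume "x \<in> ?R"
    then obtain v r where "v \<in> span D" "x + r *\<^sub>R d + v \<in> S"
      by auto
    then show "x \<in> ?L"
      by (auto simp: span_insert add.assoc intro!: exI[of _ "r *\<^sub>R d + v"] exI[of _ r])
  qed
  moreover have "polyhedron ?R"
    using insert by (intro polyhedron_plus_line) auto
  ultimately show ?case
    by (simp only:)
qed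

lemma polyhedron_linear_image:
  fixes T :: "'a::euclidean_space \<Rightarrow> 'b::euclidean_space"
  assumes "linear T" "polyhedron S"
  shows "polyhedron (T ` S)"
proof -
  \<comment> \<open>\<open>D\<close> spans the graph of \<open>- T\<close>. Hence
    \<open>(0, y)\<close> can be moved into \<open>S \<times> {0}\<close> by a vector of
    \<open>span D\<close> exactly when \<open>y = T b\<close> for some \<open>b\<close> in
    \<open>S\<close>, and the image is a slice of the polyhedron \<open>S \<times> {0}\<close> plus
    a subspace.\<close>
  define D where "D = (\<lambda>b. (b, - T b)) ` (Basis :: 'a set)"
  have lin: "linear (\<lambda>b. (b, - T b))"
    using linear_add[OF assms(1)] linear_scale[OF assms(1)] by (simp add: linear_iff)
  have D: "span D = range (\<lambda>b. (b, - T b))"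
    unfolding D_def by (simp add: linear_span_image[OF lin])
  have "S \<times> {0::'b} = fst -` S \<inter> snd -` {0::'b}"
    by auto
  then have "polyhedron (S \<times> {0::'b})"
    using assms(2) by (simp add: polyhedron_linear_vimage linear_fst linear_snd affine_imp_polyhedron)
  then have "polyhedron {x. \<exists>v\<in>span D. x + v \<in> S \<times> {0::'b}}"
    by (rule polyhedron_plus_span[rotated]) (simp add: D_def)
  then have "polyhedron ((\<lambda>y. (0::'a, y)) -` {x. \<exists>v\<in>span D. x + v \<in> S \<times> {0::'b}})"
    by (rule polyhedron_linear_vimage[rotated]) (simp add: linear_iff)
  moreover have "(\<lambda>y. (0::'a, y)) -` {x. \<exists>v\<in>span D. x + v \<in> S \<times> {0::'b}} = T ` S"
    by (auto simp: D)
  ultimately show ?thesis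
    by simp
qed

text \<open>The Minkowski sum is the image of the product under addition.\<close>

lemma polyhedron_plus:
  fixes S T :: "'a::euclidean_space set"
  assumes "polyhedron S" "polyhedron T"
  shows "polyhedron (S + T)"
proof -
  have "S \<times> T = fst -` S \<inter> snd -` T"
    by auto
  then have "polyhedron (S \<times> T)"
    using assms by (simp add: polyhedron_linear_vimage linear_fst linear_snd)
  then have "polyhedron ((\<lambda>x. fst x + snd x) ` (S \<times> T))"
    by (rule polyhedron_linear_image[rotated]) (simp add: linear_iff algebra_simps)
  moreover have "(\<lambda>x. fst x + snd x) ` (S \<times> T) = S + T"
    by (force simp: set_plus_def)
  ultimately show ?thesis
    by simp
qed

lemma polyhedron_sum:
  fixes S :: "'i \<Rightarrow> 'a::euclidean_space set"
  assumes "\<And>i. i \<in> I \<Longrightarrow> polyhedron (S i)"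
  shows "polyhedron (\<Sum>i\<in>I. S i)"
  using assms
  by (induction I rule: infinite_finite_induct)
    (auto simp: set_zero polyhedron_plus affine_imp_polyhedron)

text \<open>
  The sublinear consequence \<open>t \<ge> \<lambda> \<bullet> u\<close> is one of the inequalities of the polyhedron \<open>K\<close> that are
  active at the origin, namely one which \<open>(0, -1)\<close> violates.
\<close>

lemma polyhedron_multiplier:
  fixes K :: "('a::euclidean_space \<times> real) set"
  assumes K: "polyhedron K" and 0: "0 \<in> K" and pos: "\<And>t. (0, t) \<in> K \<Longrightarrow> t \<ge> 0"
  obtains lam where "\<And>u t. (u, t) \<in> K \<Longrightarrow> lam \<bullet> u \<le> t"
proof -
  obtain H where H: "finite H" "K = {x. \<forall>(a, b)\<in>H. a \<bullet> x \<le> b}"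
    using K polyhedron_inequalities by blast
  have b: "snd h \<ge> 0" if "h \<in> H" for h
    using 0 that by (auto simp: H(2))
  have "\<exists>h\<in>H. snd h = 0 \<and> snd (fst h) < 0"
  proof (rule ccontr)
    assume neg: "\<not> ?thesis"
    \<comment> \<open>A step so small that moving from the origin to \<open>(0, - e)\<close> keeps
      every inequality with positive right-hand side; those with right-hand side 0 survive by
      \<open>neg\<close>. The inserted 1 covers the case that there are none of the former, and the
      summand 1 in the denominator excludes division by zero.\<close>
    define e where "e = Min (insert 1 ((\<lambda>h. snd h / (\<bar>snd (fst h)\<bar> + 1)) ` {h\<in>H. snd h > 0}))"
    have e: "e > 0"
      using H(1) by (auto simp: e_def)
    have "(0, - e) \<in> K"
    proof -
      have "- (snd (fst h) * e) \<le> snd h" if "h \<in> H" for h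
      proof (cases "snd h = 0")
        case True
        then show ?thesis
          using neg that e by (simp add: not_less)
      next
        case False
        then have h: "snd h > 0"
          using b[OF that] by simp
        then have "e \<le> snd h / (\<bar>snd (fst h)\<bar> + 1)"
          unfolding e_def using that H(1) by (intro Min_le) auto
        then have "e * (\<bar>snd (fst h)\<bar> + 1) \<le> snd h"
          by (simp add: pos_le_divide_eq)
        moreover have "- (snd (fst h) * e) \<le> e * \<bar>snd (fst h)\<bar>"
          using e by (simp add: abs_if)
        ultimately show ?thesis
          using e by (simp add: algebra_simps)
      qed
      then show ?thesis
        by (auto simp: H(2) inner_Pair_0)
    qed
    then show False
      using pos e by fastforce
  qed
  then obtain a r where h: "((a, r), 0) \<in> H" "r < 0"
    by force
  \<comment> \<open>Dividing by \<open>- r\<close> normalises the coefficient of \<open>t\<close> to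
    -1.\<close>
  have "(a /\<^sub>R (- r)) \<bullet> u \<le> t" if "(u, t) \<in> K" for u t
  proof -
    have "a \<bullet> u + r * t \<le> 0"
      using that h by (auto simp: H(2))
    then show ?thesis
      using h(2) by (simp add: field_simps)
  qed
  then show ?thesis
    using that by blast
qed

section \<open>Existence of a Lagrange multiplier\<close>

text \<open>Separate the strict epigraph of \<open>F\<close> from a reflection of \<open>K\<close>;
  finiteness of \<open>F\<close> on the whole space keeps the separating hyperplane from being
  vertical. With \<open>K\<close> the epigraph of a second convex function this is the
  subdifferential sum rule: \<open>v\<close> is a subgradient of \<open>F\<close> and
  \<open>- v\<close> one of the second function.\<close>

lemma convex_sum_minimizer_subgradient:
  fixes F :: "'a::euclidean_space \<Rightarrow> real" and K :: "('a \<times> real) set"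
  assumes F: "convex_on UNIV F" and K: "convex K" and x: "(x, m) \<in> K"
    and min: "\<And>u t. (u, t) \<in> K \<Longrightarrow> F x + m \<le> F u + t"
  obtains v where "\<And>u. F x + v \<bullet> (u - x) \<le> F u" "\<And>u t. (u, t) \<in> K \<Longrightarrow> m \<le> v \<bullet> (u - x) + t"
proof -
  define S where "S = {(u, r). F u < r}"
  \<comment> \<open>A common point of \<open>S\<close> and \<open>T\<close> would have
    \<open>F u < F x + m - t\<close> with \<open>(u, t)\<close> in \<open>K\<close>, against the
    minimality of \<open>(x, m)\<close>.\<close>
  define T where "T = (\<lambda>(u, t). (u, F x + m - t)) ` K"
  have "convex S"
    unfolding S_def convex_alt
  proof (clarsimp, goal_cases)
    case (1 y r z t \<theta>)
    have "F ((1 - \<theta>) *\<^sub>R y + \<theta> *\<^sub>R z) \<le> (1 - \<theta>) * F y + \<theta> * F z"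
      using convex_onD[OF F, of \<theta> y z] 1 by simp
    also have "\<dots> < (1 - \<theta>) * r + \<theta> * t"
      using 1 by (smt (verit, best) mult_left_mono mult_strict_left_mono)
    finally show ?case .
  qed
  moreover have "convex T"
  proof -
    have "T = (\<lambda>y. (0, F x + m) + y) ` (\<lambda>(u, t). (u, - t)) ` K"
      by (force simp: T_def image_image)
    moreover have "convex ((\<lambda>(u, t). (u, - t)) ` K)"
      by (rule convex_linear_image[OF _ K]) (auto simp: linear_iff)
    ultimately show ?thesis
      by (simp add: convex_translation)
  qed
  moreover have "(x, F x + 1) \<in> S" "(x, F x) \<in> T"
    using x by (force simp: S_def T_def)+
  moreover have "S \<inter> T = {}"
    using min by (force simp: S_def T_def not_less[symmetric])
  ultimately obtain n \<gamma> where n: "n \<noteq> 0" "\<And>z. z \<in> S \<Longrightarrow> n \<bullet> z \<le> \<gamma>" "\<And>z. z \<in> T \<Longrightarrow> n \<bullet> z \<ge> \<gamma>"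
    using separating_hyperplane_sets[of S T] by blast
  obtain a b where ab: "n = (a, b)"
    by (cases n)
  have S: "a \<bullet> u + b * r \<le> \<gamma>" if "F u < r" for u r
    using n(2)[of "(u, r)"] that by (simp add: S_def ab)
  have T: "a \<bullet> u + b * (F x + m - t) \<ge> \<gamma>" if "(u, t) \<in> K" for u t
    using n(3)[of "(u, F x + m - t)"] that by (force simp: T_def ab)
  have Tx: "a \<bullet> x + b * F x \<ge> \<gamma>"
    using T[OF x] by simp
  have "b \<le> 0"
    using S[of x "F x + 1"] Tx by (simp add: algebra_simps)
  \<comment> \<open>A vertical hyperplane would give a linear functional bounded above on the whole
    space, hence \<open>n = 0\<close>.\<close>
  moreover have "b \<noteq> 0"
  proof
    assume "b = 0"
    then have "a \<bullet> u \<le> a \<bullet> x" for u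
      using S[of u "F u + 1"] Tx by simp
    from this[of "x + a"] have "a \<bullet> a \<le> 0"
      by (simp add: inner_add_right)
    then have "a = 0"
      by (metis inner_ge_zero inner_eq_zero_iff order_antisym)
    with \<open>b = 0\<close> n(1) ab show False
      by (simp add: zero_prod_def)
  qed
  ultimately have b: "b < 0"
    by simp
  \<comment> \<open>The bound on the strict epigraph passes to its boundary; raising the height by
    the positive number \<open>- e / b\<close> costs exactly \<open>e\<close>.\<close>
  have S': "a \<bullet> u + b * F u \<le> \<gamma>" for u
  proof (rule field_le_epsilon)
    fix e :: real assume "e > 0"
    then have "F u < F u - e / b"
      using b by (simp add: divide_pos_neg)
    from S[OF this] show "a \<bullet> u + b * F u \<le> \<gamma> + e"
      using b by (simp add: right_diff_distrib)
  qed
  show ?thesis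
  proof (rule that[of "a /\<^sub>R (- b)"])
    show "F x + (a /\<^sub>R - b) \<bullet> (u - x) \<le> F u" for u
      using S'[of u] Tx b by (simp add: field_simps inner_diff_right)
    show "m \<le> (a /\<^sub>R - b) \<bullet> (u - x) + t" if "(u, t) \<in> K" for u t
      using T[OF that] S'[of x] b by (simp add: field_simps inner_diff_right)
  qed
qed

text \<open>Induction on \<open>S\<close>: all but one of the functions are treated with the last
  one counted in \<open>h\<close>; after that only one function is left next to a linearised
  remainder. A point \<open>z\<close> stands for whole families of blocks, which are functions on
  the naturals and form no Euclidean space; so convexity of \<open>Z\<close> and \<open>h\<close> is
  expressed by the existence of a suitable \<open>v\<close>.\<close>

lemma convex_sum_minimizer_subgradients:
  fixes F :: "'i \<Rightarrow> 'a::euclidean_space \<Rightarrow> real" and u :: "'i \<Rightarrow> 'z \<Rightarrow> 'a"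
  assumes "finite S" and "\<And>k. k \<in> S \<Longrightarrow> convex_on UNIV (F k)"
    and "\<And>z w t. \<lbrakk>z \<in> Z; w \<in> Z; 0 \<le> t; t \<le> 1\<rbrakk> \<Longrightarrow> \<exists>v\<in>Z. h v \<le> (1 - t) * h z + t * h w \<and>
           (\<forall>k\<in>S. u k v = (1 - t) *\<^sub>R u k z + t *\<^sub>R u k w)"
    and "z0 \<in> Z"
    and "\<And>z. z \<in> Z \<Longrightarrow> h z0 + (\<Sum>k\<in>S. F k (u k z0)) \<le> h z + (\<Sum>k\<in>S. F k (u k z))"
  shows "\<exists>G. (\<forall>k\<in>S. \<forall>x. F k (u k z0) + G k \<bullet> (x - u k z0) \<le> F k x) \<and>
           (\<forall>z\<in>Z. h z0 \<le> h z + (\<Sum>k\<in>S. G k \<bullet> (u k z - u k z0)))"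
  using assms
proof (induction S arbitrary: h rule: finite_induct)
  case empty
  then show ?case by simp
next
  case (insert k S)
  note comb = insert.prems(2)
  have "\<exists>G. (\<forall>j\<in>S. \<forall>x. F j (u j z0) + G j \<bullet> (x - u j z0) \<le> F j x) \<and>
      (\<forall>z\<in>Z. h z0 + F k (u k z0) \<le> h z + F k (u k z) + (\<Sum>j\<in>S. G j \<bullet> (u j z - u j z0)))"
  proof (rule insert.IH)
    show "convex_on UNIV (F j)" if "j \<in> S" for j
      using insert.prems(1) that by simp
    show "z0 \<in> Z"
      by (rule insert.prems(3))
    show "h z0 + F k (u k z0) + (\<Sum>j\<in>S. F j (u j z0)) \<le> h z + F k (u k z) + (\<Sum>j\<in>S. F j (u j z))"
      if "z \<in> Z" for z
      using insert.prems(4)[OF that] insert.hyps by (simp add: add.assoc)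
    fix z w t assume t: "z \<in> Z" "w \<in> Z" "0 \<le> (t::real)" "t \<le> 1"
    then obtain v where v: "v \<in> Z" "h v \<le> (1 - t) * h z + t * h w"
      "\<forall>j\<in>insert k S. u j v = (1 - t) *\<^sub>R u j z + t *\<^sub>R u j w"
      using comb by blast
    have "F k (u k v) \<le> (1 - t) * F k (u k z) + t * F k (u k w)"
      using convex_onD[OF insert.prems(1), of k t "u k z" "u k w"] t v(3) by simp
    with v show "\<exists>v\<in>Z. h v + F k (u k v) \<le> (1 - t) * (h z + F k (u k z)) + t * (h w + F k (u k w)) \<and>
        (\<forall>j\<in>S. u j v = (1 - t) *\<^sub>R u j z + t *\<^sub>R u j w)"
      by (intro bexI[of _ v]) (auto simp: algebra_simps)
  qed
  then obtain G where G: "\<And>j x. j \<in> S \<Longrightarrow> F j (u j z0) + G j \<bullet> (x - u j z0) \<le> F j x"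
    "\<And>z. z \<in> Z \<Longrightarrow> h z0 + F k (u k z0) \<le> h z + F k (u k z) + (\<Sum>j\<in>S. G j \<bullet> (u j z - u j z0))"
    by blast
  define h' where "h' = (\<lambda>z. h z + (\<Sum>j\<in>S. G j \<bullet> (u j z - u j z0)))"
  \<comment> \<open>The epigraph of \<open>h'\<close> projected to block \<open>k\<close>; it lives
    in a Euclidean space, so separation applies.\<close>
  define K where "K = {(x, r). \<exists>z\<in>Z. x = u k z \<and> h' z \<le> r}"
  have comb': "\<exists>v\<in>Z. h' v \<le> (1 - t) * h' z + t * h' w \<and> u k v = (1 - t) *\<^sub>R u k z + t *\<^sub>R u k w"
    if t: "z \<in> Z" "w \<in> Z" "0 \<le> t" "t \<le> 1" for z w t
  proof -
    obtain v where v: "v \<in> Z" "h v \<le> (1 - t) * h z + t * h w"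
      "\<forall>j\<in>insert k S. u j v = (1 - t) *\<^sub>R u j z + t *\<^sub>R u j w"
      using comb[OF t] by blast
    have "(\<Sum>j\<in>S. G j \<bullet> (u j v - u j z0))
        = (\<Sum>j\<in>S. (1 - t) * (G j \<bullet> (u j z - u j z0)) + t * (G j \<bullet> (u j w - u j z0)))"
      by (intro sum.cong) (simp_all add: v(3) inner_add_right inner_diff_right algebra_simps)
    also have "\<dots> = (1 - t) * (\<Sum>j\<in>S. G j \<bullet> (u j z - u j z0)) + t * (\<Sum>j\<in>S. G j \<bullet> (u j w - u j z0))"
      by (simp add: sum.distrib sum_distrib_left)
    finally have "h' v \<le> (1 - t) * h' z + t * h' w"
      unfolding h'_def distrib_left using v(2) by linarith
    then show ?thesis
      using v by blast
  qed
  have "convex K"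
    unfolding convex_alt
  proof (intro ballI allI impI)
    fix a b t assume *: "a \<in> K" "b \<in> K" "0 \<le> (t::real) \<and> t \<le> 1"
    then obtain z w where zw: "z \<in> Z" "fst a = u k z" "h' z \<le> snd a" "w \<in> Z" "fst b = u k w" "h' w \<le> snd b"
      by (auto simp: K_def)
    then obtain v where v: "v \<in> Z" "h' v \<le> (1 - t) * h' z + t * h' w"
      "u k v = (1 - t) *\<^sub>R u k z + t *\<^sub>R u k w"
      using comb' *(3) by blast
    have "h' v \<le> (1 - t) * snd a + t * snd b"
      using v(2) zw *(3) by (smt (verit, best) mult_left_mono)
    then show "(1 - t) *\<^sub>R a + t *\<^sub>R b \<in> K"
      unfolding K_def using v(1,3) zw(2,5)
      by (auto simp: case_prod_beta intro!: bexI[of _ v])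
  qed
  moreover have "(u k z0, h z0) \<in> K"
    using insert.prems(3) by (force simp: K_def h'_def)
  moreover have "F k (u k z0) + h z0 \<le> F k x + r" if xr: "(x, r) \<in> K" for x r
  proof -
    obtain z where "z \<in> Z" "x = u k z" "h' z \<le> r"
      using xr by (auto simp: K_def)
    then show ?thesis
      using G(2)[of z] by (simp add: h'_def)
  qed
  ultimately obtain v where v: "\<And>x. F k (u k z0) + v \<bullet> (x - u k z0) \<le> F k x"
    "\<And>x r. (x, r) \<in> K \<Longrightarrow> h z0 \<le> v \<bullet> (x - u k z0) + r"
    using convex_sum_minimizer_subgradient[of "F k" K "u k z0" "h z0"] insert.prems(1) by blast
  have "h z0 \<le> h z + (\<Sum>j\<in>insert k S. (G(k := v)) j \<bullet> (u j z - u j z0))" if "z \<in> Z" for z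
  proof -
    have "(u k z, h' z) \<in> K"
      using that by (auto simp: K_def)
    moreover have "(\<Sum>j\<in>S. (G(k := v)) j \<bullet> (u j z - u j z0)) = (\<Sum>j\<in>S. G j \<bullet> (u j z - u j z0))"
      using insert.hyps by (intro sum.cong) auto
    ultimately show ?thesis
      using v(2)[of "u k z" "h' z"] insert.hyps by (simp add: h'_def)
  qed
  moreover have "F j (u j z0) + (G(k := v)) j \<bullet> (x - u j z0) \<le> F j x" if "j \<in> insert k S" for j x
    using G(1) v(1) that by (cases "j = k") auto
  ultimately show ?case
    by blast
qed

section \<open>Extension from coordinate subspaces, and changes of a single block\<close>

definition coord_proj :: "'m set \<Rightarrow> real ^ 'm \<Rightarrow> real ^ 'm::finite" where
  "coord_proj I x = (\<chi> k. if k \<in> I then x $ k else 0)"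

lemma linear_coord_proj: "linear (coord_proj I)"
  by (auto simp: linear_iff coord_proj_def vec_eq_iff)

lemma coord_proj_in [simp]: "coord_proj I x \<in> coord_space I"
  by (simp add: coord_proj_def coord_space_def)

lemma coord_proj_id [simp]: "x \<in> coord_space I \<Longrightarrow> coord_proj I x = x"
  by (simp add: coord_proj_def coord_space_def vec_eq_iff)

text \<open>The composition extends \<open>f\<close> to a finite convex function on the ambient
  space, as the separation argument demands.\<close>

lemma convex_on_coord_proj:
  assumes "convex_on (coord_space I) f"
  shows "convex_on UNIV (\<lambda>x. f (coord_proj I x))"
proof (rule convex_onI)
  fix t :: real and x y :: "real ^ 'a"
  assume "0 < t" "t < 1"
  then show "f (coord_proj I ((1 - t) *\<^sub>R x + t *\<^sub>R y)) \<le> (1 - t) * f (coord_proj I x) + t * f (coord_proj I y)"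
    using convex_onD[OF assms, of t "coord_proj I x" "coord_proj I y"]
    by (simp add: linear_add[OF linear_coord_proj] linear_scale[OF linear_coord_proj])
qed simp

lemma sum_fun_upd:
  fixes a :: "'i \<Rightarrow> 'b \<Rightarrow> 'c::ab_group_add"
  assumes "finite S" "i \<in> S"
  shows "(\<Sum>l\<in>S. a l ((x(i := z)) l)) = (\<Sum>l\<in>S. a l (x l)) + (a i z - a i (x i))"
proof -
  have "(\<Sum>l\<in>S - {i}. a l ((x(i := z)) l)) = (\<Sum>l\<in>S - {i}. a l (x l))"
    by (intro sum.cong) auto
  then show ?thesis
    using assms by (simp add: sum.remove)
qed

lemma residual_upd_left:
  "i \<in> {1..p} \<Longrightarrow>
    residual p q A B c (x(i := z)) y = residual p q A B c x y + A i *v (z - x i)"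
  using sum_fun_upd[of "{1..p}" i "\<lambda>l v. A l *v v" x z]
  by (simp add: residual_def matrix_vector_mult_diff_distrib)

lemma residual_upd_right:
  "j \<in> {1..q} \<Longrightarrow>
    residual p q A B c x (y(j := z)) = residual p q A B c x y + B j *v (z - y j)"
  using sum_fun_upd[of "{1..q}" j "\<lambda>l v. B l *v v" y z]
  by (simp add: residual_def matrix_vector_mult_diff_distrib)

lemma feasible_iff:
  "feasible p q A B c X Y x y \<longleftrightarrow> residual p q A B c x y = 0 \<and>
     (\<forall>i\<in>{1..p}. x i \<in> X i) \<and> (\<forall>j\<in>{1..q}. y j \<in> Y j)"
  by (auto simp: feasible_def residual_def)

text \<open>
  Replacing the objective by its linearisation at a solution, block by block, leaves a linear
  programme; its multiplier exists without a constraint qualification because the constraints are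
  polyhedral.
\<close>

lemma kkt_multiplier:
  fixes f :: "nat \<Rightarrow> real ^ 'm::finite \<Rightarrow> real" and g :: "nat \<Rightarrow> real ^ 'd::finite \<Rightarrow> real"
    and A :: "nat \<Rightarrow> real ^ 'm ^ 'n::finite" and B :: "nat \<Rightarrow> real ^ 'd ^ 'n"
  assumes f: "\<And>i. i \<in> {1..p} \<Longrightarrow> convex_on (coord_space (I i)) (f i)"
    and g: "\<And>j. j \<in> {1..q} \<Longrightarrow> convex_on (coord_space (J j)) (g j)"
    and X: "\<And>i. i \<in> {1..p} \<Longrightarrow> polyhedron (X i) \<and> X i \<subseteq> coord_space (I i)"
    and Y: "\<And>j. j \<in> {1..q} \<Longrightarrow> polyhedron (Y j) \<and> Y j \<subseteq> coord_space (J j)"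
    and sol: "(xs, ys) \<in> solution_set p q f g A B c X Y"
  obtains lam where
    "\<And>i x. i \<in> {1..p} \<Longrightarrow> x \<in> X i \<Longrightarrow> f i (xs i) + lam \<bullet> (A i *v (x - xs i)) \<le> f i x"
    "\<And>j y. j \<in> {1..q} \<Longrightarrow> y \<in> Y j \<Longrightarrow> g j (ys j) + lam \<bullet> (B j *v (y - ys j)) \<le> g j y"
proof -
  define Z where "Z = {z. feasible p q A B c X Y (fst z) (snd z)}"
  define F where "F = (\<lambda>i x. f i (coord_proj (I i) x))"
  define H where "H = (\<lambda>j y. g j (coord_proj (J j) y))"
  have F_eq: "F i x = f i x" if "i \<in> {1..p}" "x \<in> X i" for i x
    using X[OF that(1)] that(2) by (auto simp: F_def)
  have H_eq: "H j y = g j y" if "j \<in> {1..q}" "y \<in> Y j" for j y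
    using Y[OF that(1)] that(2) by (auto simp: H_def)
  have F_convex: "convex_on UNIV (F i)" if "i \<in> {1..p}" for i
    unfolding F_def using convex_on_coord_proj f that by blast
  have H_convex: "convex_on UNIV (H j)" if "j \<in> {1..q}" for j
    unfolding H_def using convex_on_coord_proj g that by blast
  have Z_D: "fst z i \<in> X i" "snd z j \<in> Y j" if "z \<in> Z" "i \<in> {1..p}" "j \<in> {1..q}" for z i j
    using that by (auto simp: Z_def feasible_def)
  have Z0: "(xs, ys) \<in> Z"
    using sol by (simp add: solution_set_def Z_def)
  have min: "(\<Sum>j=1..q. H j (ys j)) + (\<Sum>i=1..p. F i (xs i))
      \<le> (\<Sum>j=1..q. H j (snd z j)) + (\<Sum>i=1..p. F i (fst z i))" if "z \<in> Z" for z
  proof -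
    have "(\<Sum>j=1..q. H j (snd w j)) + (\<Sum>i=1..p. F i (fst w i)) = objective p q f g (fst w) (snd w)"
      if "w \<in> Z" for w
    proof -
      have "(\<Sum>j=1..q. H j (snd w j)) = (\<Sum>j=1..q. g j (snd w j))"
        using that by (intro sum.cong) (auto simp: H_eq Z_def feasible_def)
      moreover have "(\<Sum>i=1..p. F i (fst w i)) = (\<Sum>i=1..p. f i (fst w i))"
        using that by (intro sum.cong) (auto simp: F_eq Z_def feasible_def)
      ultimately show ?thesis
        by (simp add: objective_def)
    qed
    moreover have "objective p q f g xs ys \<le> objective p q f g (fst z) (snd z)"
      using sol that by (auto simp: solution_set_def Z_def)
    ultimately show ?thesis
      using that Z0 by fastforce
  qed
  define mid where "mid = (\<lambda>t (z :: (nat \<Rightarrow> real ^ 'm) \<times> (nat \<Rightarrow> real ^ 'd)) w.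
    (\<lambda>i. (1 - t) *\<^sub>R fst z i + t *\<^sub>R fst w i, \<lambda>j. (1 - t) *\<^sub>R snd z j + t *\<^sub>R snd w j))"
  have mid: "mid t z w \<in> Z" if "z \<in> Z" "w \<in> Z" "0 \<le> t" "t \<le> 1" for t z w
  proof -
    have "residual p q A B c (fst (mid t z w)) (snd (mid t z w))
        = (1 - t) *\<^sub>R residual p q A B c (fst z) (snd z) + t *\<^sub>R residual p q A B c (fst w) (snd w)"
      by (simp add: residual_def mid_def matrix_vector_right_distrib matrix_vector_mult_scaleR
          sum.distrib sum_subtractf scaleR_sum_right algebra_simps)
    moreover have "(1 - t) *\<^sub>R fst z i + t *\<^sub>R fst w i \<in> X i" if "i \<in> {1..p}" for i
      using that \<open>z \<in> Z\<close> \<open>w \<in> Z\<close> \<open>0 \<le> t\<close> \<open>t \<le> 1\<close> X[OF that]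
      by (intro convexD_alt) (auto simp: polyhedron_imp_convex Z_def feasible_def)
    moreover have "(1 - t) *\<^sub>R snd z j + t *\<^sub>R snd w j \<in> Y j" if "j \<in> {1..q}" for j
      using that \<open>z \<in> Z\<close> \<open>w \<in> Z\<close> \<open>0 \<le> t\<close> \<open>t \<le> 1\<close> Y[OF that]
      by (intro convexD_alt) (auto simp: polyhedron_imp_convex Z_def feasible_def)
    ultimately show ?thesis
      using that by (auto simp: Z_def feasible_iff mid_def)
  qed
  \<comment> \<open>First the functions \<open>F i\<close> are linearised, with the sum of the
    \<open>H j\<close> as the remaining convex function; then the \<open>H j\<close>, with the
    linear part as remainder. There are two rounds because the two groups have different block
    types.\<close>
  have "\<exists>G. (\<forall>i\<in>{1..p}. \<forall>x. F i (xs i) + G i \<bullet> (x - xs i) \<le> F i x) \<and>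
      (\<forall>z\<in>Z. (\<Sum>j=1..q. H j (ys j))
        \<le> (\<Sum>j=1..q. H j (snd z j)) + (\<Sum>i=1..p. G i \<bullet> (fst z i - xs i)))"
  proof -
    have "\<exists>v\<in>Z. (\<Sum>j=1..q. H j (snd v j)) \<le> (1 - t) * (\<Sum>j=1..q. H j (snd z j)) + t * (\<Sum>j=1..q. H j (snd w j)) \<and>
        (\<forall>i\<in>{1..p}. fst v i = (1 - t) *\<^sub>R fst z i + t *\<^sub>R fst w i)"
      if t: "z \<in> Z" "w \<in> Z" "0 \<le> t" "t \<le> 1" for z w t
    proof (intro bexI[OF _ mid[OF t]] conjI ballI)
      have "(\<Sum>j=1..q. H j (snd (mid t z w) j)) \<le> (\<Sum>j=1..q. (1 - t) * H j (snd z j) + t * H j (snd w j))"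
        using t convex_onD[OF H_convex] by (intro sum_mono) (simp add: mid_def)
      then show "(\<Sum>j=1..q. H j (snd (mid t z w) j))
          \<le> (1 - t) * (\<Sum>j=1..q. H j (snd z j)) + t * (\<Sum>j=1..q. H j (snd w j))"
        by (simp add: sum.distrib sum_distrib_left)
    qed (simp add: mid_def)
    from convex_sum_minimizer_subgradients[OF _ _ this Z0, where F = F] F_convex min
    show ?thesis
      by simp
  qed
  then obtain G where G: "\<And>i x. i \<in> {1..p} \<Longrightarrow> F i (xs i) + G i \<bullet> (x - xs i) \<le> F i x"
    and minG: "\<And>z. z \<in> Z \<Longrightarrow> (\<Sum>j=1..q. H j (ys j))
        \<le> (\<Sum>j=1..q. H j (snd z j)) + (\<Sum>i=1..p. G i \<bullet> (fst z i - xs i))"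
    by blast
  have "\<exists>G'. (\<forall>j\<in>{1..q}. \<forall>y. H j (ys j) + G' j \<bullet> (y - ys j) \<le> H j y) \<and>
      (\<forall>z\<in>Z. 0 \<le> (\<Sum>i=1..p. G i \<bullet> (fst z i - xs i)) + (\<Sum>j=1..q. G' j \<bullet> (snd z j - ys j)))"
  proof -
    have "\<exists>v\<in>Z. (\<Sum>i=1..p. G i \<bullet> (fst v i - xs i))
          \<le> (1 - t) * (\<Sum>i=1..p. G i \<bullet> (fst z i - xs i)) + t * (\<Sum>i=1..p. G i \<bullet> (fst w i - xs i)) \<and>
        (\<forall>j\<in>{1..q}. snd v j = (1 - t) *\<^sub>R snd z j + t *\<^sub>R snd w j)"
      if t: "z \<in> Z" "w \<in> Z" "0 \<le> t" "t \<le> 1" for z w t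
    proof (intro bexI[OF _ mid[OF t]] conjI ballI)
      have "(\<Sum>i=1..p. G i \<bullet> (fst (mid t z w) i - xs i))
          = (\<Sum>i=1..p. (1 - t) * (G i \<bullet> (fst z i - xs i)) + t * (G i \<bullet> (fst w i - xs i)))"
        by (intro sum.cong) (auto simp: mid_def inner_add_right inner_diff_right algebra_simps)
      then show "(\<Sum>i=1..p. G i \<bullet> (fst (mid t z w) i - xs i))
          \<le> (1 - t) * (\<Sum>i=1..p. G i \<bullet> (fst z i - xs i)) + t * (\<Sum>i=1..p. G i \<bullet> (fst w i - xs i))"
        by (simp add: sum.distrib sum_distrib_left)
    qed (simp add: mid_def)
    from convex_sum_minimizer_subgradients[OF _ _ this Z0, where F = H] H_convex minG
    show ?thesis
      by (simp add: add.commute)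
  qed
  then obtain G' where G': "\<And>j y. j \<in> {1..q} \<Longrightarrow> H j (ys j) + G' j \<bullet> (y - ys j) \<le> H j y"
    and minG': "\<And>z. z \<in> Z \<Longrightarrow> 0
        \<le> (\<Sum>i=1..p. G i \<bullet> (fst z i - xs i)) + (\<Sum>j=1..q. G' j \<bullet> (snd z j - ys j))"
    by blast
  define lin where "lin = (\<lambda>x y. (\<Sum>i=1..p. G i \<bullet> (x i - xs i)) + (\<Sum>j=1..q. G' j \<bullet> (y j - ys j)))"
  \<comment> \<open>The attainable pairs of residual and linearised objective change when each block
    varies freely in its own set. The coupling constraint is the slice at residual 0, where
    \<open>minG'\<close> makes the second entry nonnegative.\<close>
  define K where "K = (\<Sum>i=1..p. (\<lambda>x. (A i *v x, G i \<bullet> x)) ` X i)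
    + (\<Sum>j=1..q. (\<lambda>y. (B j *v y, G' j \<bullet> y)) ` Y j)
    + {(- c, - (\<Sum>i=1..p. G i \<bullet> xs i) - (\<Sum>j=1..q. G' j \<bullet> ys j))}"
  have lin_eq: "(\<Sum>i=1..p. (A i *v x i, G i \<bullet> x i)) + (\<Sum>j=1..q. (B j *v y j, G' j \<bullet> y j))
      + (- c, - (\<Sum>i=1..p. G i \<bullet> xs i) - (\<Sum>j=1..q. G' j \<bullet> ys j)) = (residual p q A B c x y, lin x y)"
    for x y
    by (simp add: residual_def lin_def sum_prod inner_diff_right sum_subtractf)
  have K_I: "(residual p q A B c x y, lin x y) \<in> K"
    if "\<And>i. i \<in> {1..p} \<Longrightarrow> x i \<in> X i" "\<And>j. j \<in> {1..q} \<Longrightarrow> y j \<in> Y j" for x y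
    unfolding lin_eq[symmetric] K_def using that
    by (intro set_plus_intro) (auto simp: set_sum_alt)
  have K_D: "\<exists>x y. (\<forall>i\<in>{1..p}. x i \<in> X i) \<and> (\<forall>j\<in>{1..q}. y j \<in> Y j) \<and>
      k = (residual p q A B c x y, lin x y)" if k: "k \<in> K" for k
  proof -
    obtain a b where ab: "k = sum a {1..p} + sum b {1..q}
        + (- c, - (\<Sum>i=1..p. G i \<bullet> xs i) - (\<Sum>j=1..q. G' j \<bullet> ys j))"
      "\<forall>i\<in>{1..p}. a i \<in> (\<lambda>x. (A i *v x, G i \<bullet> x)) ` X i"
      "\<forall>j\<in>{1..q}. b j \<in> (\<lambda>y. (B j *v y, G' j \<bullet> y)) ` Y j"
      using k unfolding K_def by (auto simp: set_sum_alt elim!: set_plus_elim)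
    obtain x where x: "\<forall>i\<in>{1..p}. x i \<in> X i \<and> a i = (A i *v x i, G i \<bullet> x i)"
      using bchoice[of "{1..p}" "\<lambda>i x. x \<in> X i \<and> a i = (A i *v x, G i \<bullet> x)"] ab(2) by blast
    obtain y where y: "\<forall>j\<in>{1..q}. y j \<in> Y j \<and> b j = (B j *v y j, G' j \<bullet> y j)"
      using bchoice[of "{1..q}" "\<lambda>j y. y \<in> Y j \<and> b j = (B j *v y, G' j \<bullet> y)"] ab(3) by blast
    have "k = (residual p q A B c x y, lin x y)"
      unfolding lin_eq[symmetric] ab(1) using x y by simp
    then show ?thesis
      using x y by blast
  qed
  have "polyhedron K"
    unfolding K_def
  proof (intro polyhedron_plus polyhedron_sum)
    show "polyhedron ((\<lambda>x. (A i *v x, G i \<bullet> x)) ` X i)" if "i \<in> {1..p}" for i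
      using X[OF that] by (intro polyhedron_linear_image)
        (auto simp: linear_iff matrix_vector_right_distrib matrix_vector_mult_scaleR inner_add_right)
    show "polyhedron ((\<lambda>y. (B j *v y, G' j \<bullet> y)) ` Y j)" if "j \<in> {1..q}" for j
      using Y[OF that] by (intro polyhedron_linear_image)
        (auto simp: linear_iff matrix_vector_right_distrib matrix_vector_mult_scaleR inner_add_right)
  qed (simp add: affine_imp_polyhedron)
  moreover have "0 \<in> K"
    using K_I[of xs ys] Z0 by (auto simp: Z_def feasible_iff lin_def zero_prod_def)
  moreover have "t \<ge> 0" if t: "(0, t) \<in> K" for t
  proof -
    obtain x y where "(x, y) \<in> Z" "t = lin x y"
      using K_D[OF t] by (auto simp: Z_def feasible_iff)
    then show ?thesis
      using minG'[of "(x, y)"] by (simp add: lin_def)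
  qed
  ultimately obtain lam where lam: "\<And>u t. (u, t) \<in> K \<Longrightarrow> lam \<bullet> u \<le> t"
    using polyhedron_multiplier by blast
  show ?thesis
  proof (rule that)
    have xs: "xs i \<in> X i" if "i \<in> {1..p}" for i
      using that Z0 by (auto simp: Z_def feasible_def)
    have ys: "ys j \<in> Y j" if "j \<in> {1..q}" for j
      using that Z0 by (auto simp: Z_def feasible_def)
    have res: "residual p q A B c xs ys = 0"
      using Z0 by (simp add: Z_def feasible_iff)
    show "f i (xs i) + lam \<bullet> (A i *v (x - xs i)) \<le> f i x" if "i \<in> {1..p}" "x \<in> X i" for i x
    proof -
      \<comment> \<open>Changing only block \<open>i\<close> of the solution isolates the inequality
        of that block.\<close>
      have "(residual p q A B c (xs(i := x)) ys, lin (xs(i := x)) ys) \<in> K"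
        using xs ys that by (intro K_I) auto
      moreover have "lin (xs(i := x)) ys = G i \<bullet> (x - xs i)"
        using sum_fun_upd[of "{1..p}" i "\<lambda>l v. G l \<bullet> (v - xs l)" xs x] that(1) by (simp add: lin_def)
      ultimately have "lam \<bullet> (A i *v (x - xs i)) \<le> G i \<bullet> (x - xs i)"
        using lam that(1) by (simp add: residual_upd_left res)
      then show ?thesis
        using G[OF that(1), of x] F_eq xs that by simp
    qed
    show "g j (ys j) + lam \<bullet> (B j *v (y - ys j)) \<le> g j y" if "j \<in> {1..q}" "y \<in> Y j" for j y
    proof -
      have "(residual p q A B c xs (ys(j := y)), lin xs (ys(j := y))) \<in> K"
        using xs ys that by (intro K_I) auto
      moreover have "lin xs (ys(j := y)) = G' j \<bullet> (y - ys j)"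
        using sum_fun_upd[of "{1..q}" j "\<lambda>l v. G' l \<bullet> (v - ys l)" ys y] that(1) by (simp add: lin_def)
      ultimately have "lam \<bullet> (B j *v (y - ys j)) \<le> G' j \<bullet> (y - ys j)"
        using lam that(1) by (simp add: residual_upd_right res)
      then show ?thesis
        using G'[OF that(1), of y] H_eq ys that by simp
    qed
  qed
qed

section \<open>Prediction-correction schemes\<close>

text \<open>By \<open>sol\<close> each step lowers the squared \<open>h\<close>-distance to
  \<open>ws\<close> by at least \<open>2 * h e (M e) - h (M e) (M e)\<close>, so by \<open>C\<close>
  the values \<open>h (M (e k)) (M (e k))\<close> have a bounded sum. \<open>mono\<close> makes them
  nonincreasing, so the last of the first \<open>t + 1\<close> of them is at most their
  average.\<close>

lemma prediction_correction_rate: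
  fixes h :: "'w::ab_group_add \<Rightarrow> 'w \<Rightarrow> real" and M :: "'w \<Rightarrow> 'w"
  assumes h_diff: "\<And>x y z. h (x - y) z = h x z - h y z" and h_sym: "\<And>x y. h x y = h y x"
    and h_nonneg: "\<And>x. h x x \<ge> 0" and M_diff: "\<And>x y. M (x - y) = M x - M y"
    and C: "C > 0" "\<And>x. h (M x) (M x) \<le> C * (2 * h x (M x) - h (M x) (M x))"
    and step: "\<And>k. w (Suc k) = w k - M (e k)"
    and sol: "\<And>k. h (w k - e k - ws) (M (e k)) \<ge> 0"
    and mono: "\<And>k. h (w k - e k - (w (Suc k) - e (Suc k))) (M (e k - e (Suc k))) \<ge> 0"
  shows "(real t + 1) * h (M (e t)) (M (e t)) \<le> C * h (w 0 - ws) (w 0 - ws)"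
proof -
  have h_diff': "h z (x - y) = h z x - h z y" for x y z
    by (metis h_diff h_sym)
  define G where "G = (\<lambda>x. 2 * h x (M x) - h (M x) (M x))"
  have G: "G x \<ge> 0" for x
  proof -
    have "0 \<le> C * G x"
      using C(2)[of x] h_nonneg[of "M x"] by (simp add: G_def)
    then show ?thesis
      using C(1) by (simp add: zero_le_mult_iff)
  qed
  have decrease: "G (e k) \<le> h (w k - ws) (w k - ws) - h (w (Suc k) - ws) (w (Suc k) - ws)" for k
  proof -
    have "h (w (Suc k) - ws) (w (Suc k) - ws)
        = h (w k - ws) (w k - ws) - 2 * h (w k - ws) (M (e k)) + h (M (e k)) (M (e k))"
      unfolding step h_diff h_diff' using h_sym by (simp add: algebra_simps)
    then show ?thesis
      using sol[of k] by (simp add: G_def h_diff)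
  qed
  have "h (M (e (Suc k))) (M (e (Suc k))) \<le> h (M (e k)) (M (e k))" for k
  proof -
    \<comment> \<open>Consecutive predictions differ by \<open>M (e k) - d\<close>, so
      \<open>mono\<close> bounds \<open>h d (M d)\<close> by the cross term
      \<open>h (M (e k)) (M d)\<close>, and the decrease is at least \<open>G d\<close>.\<close>
    define d where "d = e k - e (Suc k)"
    have eq: "w k - e k - (w (Suc k) - e (Suc k)) = M (e k) - d"
      by (simp add: step d_def)
    have "h d (M d) \<le> h (M (e k)) (M d)"
      using mono[of k] unfolding eq d_def[symmetric] h_diff by simp
    moreover have "M (e (Suc k)) = M (e k) - M d"
      by (simp add: d_def M_diff)
    then have "h (M (e (Suc k))) (M (e (Suc k)))
        = h (M (e k)) (M (e k)) - 2 * h (M (e k)) (M d) + h (M d) (M d)"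
      unfolding h_diff h_diff' using h_sym[of "M d" "M (e k)"] by (simp add: h_diff h_diff')
    ultimately show ?thesis
      using G[of d] by (simp add: G_def)
  qed
  then have "decseq (\<lambda>k. h (M (e k)) (M (e k)))"
    by (simp add: decseq_Suc_iff)
  then have "(real t + 1) * h (M (e t)) (M (e t)) \<le> (\<Sum>k\<le>t. h (M (e k)) (M (e k)))"
    using sum_bounded_below[of "{..t}" "h (M (e t)) (M (e t))"]
    by (simp add: decseq_def algebra_simps)
  also have "\<dots> \<le> (\<Sum>k\<le>t. C * (h (w k - ws) (w k - ws) - h (w (Suc k) - ws) (w (Suc k) - ws)))"
  proof (rule sum_mono)
    fix k
    have "h (M (e k)) (M (e k)) \<le> C * G (e k)"
      using C(2) by (simp add: G_def)
    also have "\<dots> \<le> C * (h (w k - ws) (w k - ws) - h (w (Suc k) - ws) (w (Suc k) - ws))"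
      using C(1) decrease by (intro mult_left_mono) auto
    finally show "h (M (e k)) (M (e k)) \<le> \<dots>" .
  qed
  also have "\<dots> = C * (h (w 0 - ws) (w 0 - ws) - h (w (Suc t) - ws) (w (Suc t) - ws))"
    using sum_telescope[of "\<lambda>k. h (w k - ws) (w k - ws)" t] by (simp flip: sum_distrib_left)
  also have "\<dots> \<le> C * h (w 0 - ws) (w 0 - ws)"
    using C(1) h_nonneg by (intro mult_left_mono) auto
  finally show ?thesis .
qed

section \<open>Norm inequalities; the metric and the correction of GS-ADMM\<close>

lemma norm_sum_squared_le:
  "(norm (\<Sum>i\<in>S. a i))\<^sup>2 \<le> real (card S) * (\<Sum>i\<in>S. (norm (a i))\<^sup>2)"
proof -
  have "(norm (\<Sum>i\<in>S. a i))\<^sup>2 \<le> (\<Sum>i\<in>S. norm (a i))\<^sup>2"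
    by (intro power_mono norm_sum) simp
  also have "\<dots> \<le> real (card S) * (\<Sum>i\<in>S. (norm (a i))\<^sup>2)"
    using sum_squared_le_sum_of_squares[of "\<lambda>i. norm (a i)" S] by (simp add: mult.commute)
  finally show ?thesis .
qed

lemma norm_add_squared_le:
  "(norm (x + y))\<^sup>2 \<le> 2 * (norm x)\<^sup>2 + 2 * (norm y)\<^sup>2"
proof -
  have "(norm (x + y))\<^sup>2 \<le> (norm x + norm y)\<^sup>2"
    by (intro power_mono norm_triangle_ineq) simp
  also have "\<dots> \<le> 2 * (norm x)\<^sup>2 + 2 * (norm y)\<^sup>2"
    using sum_squares_bound[of "norm x" "norm y"] by (simp add: power2_sum)
  finally show ?thesis .
qed

text \<open>
  The recursion lives in the image spaces: a state consists of the vectors \<open>A\<^sub>i x\<^sub>i\<close>, the vectors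
  \<open>B\<^sub>j y\<^sub>j\<close> and the multiplier. In the notation of prediction-correction methods, \<open>corr\<close> is the
  correction matrix \<open>M\<close>, \<open>form\<close> is the metric \<open>H = Q M\<^sup>-\<^sup>1\<close>.
\<close>

type_synonym 'v state = "(nat \<Rightarrow> 'v) \<times> (nat \<Rightarrow> 'v) \<times> 'v"

text \<open>The locale holds parameters only, no iterates, so that constants derived in it are the
  same for all runs.\<close>

locale gs_params =
  fixes p q :: nat and \<beta> \<sigma>1 \<sigma>2 \<tau> s :: real
  assumes \<beta>: "\<beta> > 0" and \<sigma>1: "\<sigma>1 > real p - 1" and \<sigma>2: "\<sigma>2 > real q - 1"
    and step: "\<tau> < 1" "s < 1" "\<tau> + s > 0" and pq: "p \<ge> 1" "q \<ge> 1"
begin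

definition sum1 :: "'v state \<Rightarrow> 'v::real_inner" where
  "sum1 w = (\<Sum>i=1..p. fst w i)"

definition sum2 :: "'v state \<Rightarrow> 'v::real_inner" where
  "sum2 w = (\<Sum>j=1..q. fst (snd w) j)"

definition corr :: "'v::real_inner state \<Rightarrow> 'v state" where
  "corr w = (fst w, fst (snd w), (\<tau> + s) *\<^sub>R snd (snd w) - (s * \<beta>) *\<^sub>R sum2 w)"

definition form :: "'v::real_inner state \<Rightarrow> 'v state \<Rightarrow> real" where
  "form w w' = \<beta> * ((\<sigma>1 + 1) * (\<Sum>i=1..p. fst w i \<bullet> fst w' i) - sum1 w \<bullet> sum1 w')
     + \<beta> * ((\<sigma>2 + 1) * (\<Sum>j=1..q. fst (snd w) j \<bullet> fst (snd w') j) - \<tau> * (sum2 w \<bullet> sum2 w'))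
     + (snd (snd w) - (\<tau> * \<beta>) *\<^sub>R sum2 w) \<bullet> (snd (snd w') - (\<tau> * \<beta>) *\<^sub>R sum2 w') / (\<beta> * (\<tau> + s))"

definition sq1 :: "'v::real_inner state \<Rightarrow> real" where
  "sq1 w = (\<Sum>i=1..p. (norm (fst w i))\<^sup>2)"

definition sq2 :: "'v::real_inner state \<Rightarrow> real" where
  "sq2 w = (\<Sum>j=1..q. (norm (fst (snd w) j))\<^sup>2)"

definition sq3 :: "'v::real_inner state \<Rightarrow> real" where
  "sq3 w = (norm (snd (snd w)))\<^sup>2"

lemma sq_nonneg [simp]: "sq1 w \<ge> 0" "sq2 w \<ge> 0" "sq3 w \<ge> 0"
  by (simp_all add: sq1_def sq2_def sq3_def sum_nonneg)

lemma sum1_diff: "sum1 (w - w') = sum1 w - sum1 w'"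
  by (simp add: sum1_def sum_subtractf)

lemma sum2_diff: "sum2 (w - w') = sum2 w - sum2 w'"
  by (simp add: sum2_def sum_subtractf)

lemma sum_corr [simp]: "sum1 (corr w) = sum1 w" "sum2 (corr w) = sum2 w"
  by (simp_all add: sum1_def sum2_def corr_def)

lemma corr_diff: "corr (w - w') = corr w - corr w'"
  by (simp add: corr_def sum2_diff prod_eq_iff algebra_simps)

lemma form_sym: "form w w' = form w' w"
  by (simp add: form_def inner_commute)

lemma form_diff: "form (w - w') v = form w v - form w' v"
proof -
  have "(snd (snd (w - w')) - (\<tau> * \<beta>) *\<^sub>R sum2 (w - w'))
      = (snd (snd w) - (\<tau> * \<beta>) *\<^sub>R sum2 w) - (snd (snd w') - (\<tau> * \<beta>) *\<^sub>R sum2 w')"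
    by (simp add: sum2_diff algebra_simps)
  then show ?thesis
    unfolding form_def
    by (simp add: sum1_diff sum2_diff inner_diff_left sum_subtractf diff_divide_distrib right_diff_distrib)
qed

text \<open>Here and in \<open>sum2_le\<close> the number of blocks enters; it leads to the
  thresholds \<open>\<sigma>1 + 1 > p\<close> and \<open>\<sigma>2 + 1 > q\<close> for
  definiteness.\<close>

lemma sum1_le: "(norm (sum1 w))\<^sup>2 \<le> real p * sq1 w"
  using norm_sum_squared_le[of "fst w" "{1..p}"] by (simp add: sum1_def sq1_def)

lemma sum2_le: "(norm (sum2 w))\<^sup>2 \<le> real q * sq2 w"
  using norm_sum_squared_le[of "fst (snd w)" "{1..q}"] by (simp add: sum2_def sq2_def)

text \<open>The start of a run is prescribed only on the indices from 1 to \<open>p\<close> and from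
  1 to \<open>q\<close>; elsewhere its initial state is arbitrary, which the form does not
  see.\<close>

lemma form_cong:
  assumes "\<And>i. i \<in> {1..p} \<Longrightarrow> fst w i = fst w' i" "\<And>j. j \<in> {1..q} \<Longrightarrow> fst (snd w) j = fst (snd w') j"
    and "snd (snd w) = snd (snd w')"
  shows "form (w - v) (w - v) = form (w' - v) (w' - v)"
proof -
  have "sum1 (w - v) = sum1 (w' - v)" "sum2 (w - v) = sum2 (w' - v)"
    using assms by (simp_all add: sum1_def sum2_def)
  moreover have "(\<Sum>i=1..p. fst (w - v) i \<bullet> fst (w - v) i) = (\<Sum>i=1..p. fst (w' - v) i \<bullet> fst (w' - v) i)"
    "(\<Sum>j=1..q. fst (snd (w - v)) j \<bullet> fst (snd (w - v)) j)
      = (\<Sum>j=1..q. fst (snd (w' - v)) j \<bullet> fst (snd (w' - v)) j)"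
    using assms by simp_all
  ultimately show ?thesis
    unfolding form_def using assms(3) by simp
qed

text \<open>The square in \<open>form\<close> is completed at the shift by
  \<open>\<tau> * \<beta>\<close> times \<open>sum2\<close> because the correction then produces a
  factor \<open>\<tau> + s\<close>, which cancels against the denominator.\<close>

lemma snd_corr_shift:
  "snd (snd (corr w)) - (\<tau> * \<beta>) *\<^sub>R sum2 w = (\<tau> + s) *\<^sub>R (snd (snd w) - \<beta> *\<^sub>R sum2 w)"
  by (simp add: corr_def algebra_simps)

lemma form_self:
  "form w w = \<beta> * ((\<sigma>1 + 1) * sq1 w - (norm (sum1 w))\<^sup>2)
     + \<beta> * ((\<sigma>2 + 1) * sq2 w - \<tau> * (norm (sum2 w))\<^sup>2)
     + (norm (snd (snd w) - (\<tau> * \<beta>) *\<^sub>R sum2 w))\<^sup>2 / (\<beta> * (\<tau> + s))"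
  by (simp add: form_def sq1_def sq2_def power2_norm_eq_inner)

lemma sq_corr [simp]: "sq1 (corr w) = sq1 w" "sq2 (corr w) = sq2 w"
  by (simp_all add: sq1_def sq2_def corr_def)

lemma form_corr_self:
  "form (corr w) (corr w) = \<beta> * ((\<sigma>1 + 1) * sq1 w - (norm (sum1 w))\<^sup>2)
     + \<beta> * ((\<sigma>2 + 1) * sq2 w - \<tau> * (norm (sum2 w))\<^sup>2)
     + (\<tau> + s) / \<beta> * (norm (snd (snd w) - \<beta> *\<^sub>R sum2 w))\<^sup>2"
proof -
  have "(norm ((\<tau> + s) *\<^sub>R (snd (snd w) - \<beta> *\<^sub>R sum2 w)))\<^sup>2 / (\<beta> * (\<tau> + s))
      = (\<tau> + s) / \<beta> * (norm (snd (snd w) - \<beta> *\<^sub>R sum2 w))\<^sup>2"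
    using \<beta> step(3) by (simp add: power_mult_distrib power2_eq_square)
  then show ?thesis
    unfolding form_self by (simp add: snd_corr_shift)
qed

text \<open>This is the bilinear form of Q, the product of metric and correction: the factor
  \<open>\<tau> + s\<close> cancels, and so do the terms in
  \<open>sum2 v \<bullet> sum2 w\<close>.\<close>

lemma form_corr:
  "form v (corr w) = \<beta> * ((\<sigma>1 + 1) * (\<Sum>i=1..p. fst v i \<bullet> fst w i) - sum1 v \<bullet> sum1 w)
     + (\<sigma>2 + 1) * \<beta> * (\<Sum>j=1..q. fst (snd v) j \<bullet> fst (snd w) j) - \<tau> * (sum2 v \<bullet> snd (snd w))
     + snd (snd v) \<bullet> (snd (snd w) /\<^sub>R \<beta> - sum2 w)"
proof -
  have "(snd (snd v) - (\<tau> * \<beta>) *\<^sub>R sum2 v) \<bullet> ((\<tau> + s) *\<^sub>R (snd (snd w) - \<beta> *\<^sub>R sum2 w)) / (\<beta> * (\<tau> + s))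
      = (snd (snd v) - (\<tau> * \<beta>) *\<^sub>R sum2 v) \<bullet> (snd (snd w) - \<beta> *\<^sub>R sum2 w) / \<beta>"
    using step(3) by simp
  also have "\<dots> = snd (snd v) \<bullet> (snd (snd w) /\<^sub>R \<beta> - sum2 w) - \<tau> * (sum2 v \<bullet> snd (snd w))
      + \<tau> * \<beta> * (sum2 v \<bullet> sum2 w)"
    using \<beta> by (simp add: inner_diff_left inner_diff_right field_simps)
  finally show ?thesis
    unfolding form_def by (simp add: snd_corr_shift) (simp add: corr_def algebra_simps)
qed

text \<open>The left-hand side is the quadratic form of \<open>G = Q + Q\<^sup>T - M\<^sup>T H M\<close>.\<close>

lemma gap_eq:
  "2 * form w (corr w) - form (corr w) (corr w)
     = \<beta> * ((\<sigma>1 + 1) * sq1 w - (norm (sum1 w))\<^sup>2)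
       + \<beta> * ((\<sigma>2 + 1) * sq2 w - (norm (sum2 w))\<^sup>2)
       + (1 - s) / \<beta> * (norm (snd (snd w) - \<beta> *\<^sub>R sum2 w))\<^sup>2 + (1 - \<tau>) / \<beta> * sq3 w"
proof -
  define l S where "l = snd (snd w)" and "S = sum2 w"
  have sq: "(norm (l - \<beta> *\<^sub>R S))\<^sup>2 = (norm l)\<^sup>2 - 2 * \<beta> * (l \<bullet> S) + \<beta>\<^sup>2 * (norm S)\<^sup>2"
    unfolding power2_norm_eq_inner
    by (simp add: inner_diff_left inner_diff_right inner_commute power2_eq_square algebra_simps)
  have l: "l \<bullet> (l /\<^sub>R \<beta> - S) = (norm l)\<^sup>2 / \<beta> - l \<bullet> S"
    by (simp add: power2_norm_eq_inner inner_diff_right divide_inverse)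
  have form: "form w (corr w) = \<beta> * ((\<sigma>1 + 1) * sq1 w - (norm (sum1 w))\<^sup>2)
      + (\<sigma>2 + 1) * \<beta> * sq2 w - \<tau> * (l \<bullet> S) + l \<bullet> (l /\<^sub>R \<beta> - S)"
    by (simp add: form_corr sq1_def sq2_def power2_norm_eq_inner l_def S_def inner_commute)
  show ?thesis
    unfolding form form_corr_self l_def[symmetric] S_def[symmetric] sq3_def sq l
    using \<beta> by (simp add: field_simps power2_eq_square)
qed

section \<open>Definiteness of the metric and of the gap\<close>

lemma sum_bounds:
  "(\<sigma>1 + 1 - real p) * sq1 w \<le> (\<sigma>1 + 1) * sq1 w - (norm (sum1 w))\<^sup>2"
  "(\<sigma>2 + 1 - real q) * sq2 w \<le> (\<sigma>2 + 1) * sq2 w - (norm (sum2 w))\<^sup>2"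
  using sum1_le[of w] sum2_le[of w] by (simp_all add: algebra_simps)

lemma sum2_bound:
  "(\<sigma>2 + 1 - real q) * sq2 w \<le> (\<sigma>2 + 1) * sq2 w - \<tau> * (norm (sum2 w))\<^sup>2"
proof -
  have "\<tau> * (norm (sum2 w))\<^sup>2 \<le> 1 * (norm (sum2 w))\<^sup>2"
    using step(1) by (intro mult_right_mono) auto
  then show ?thesis
    using sum_bounds(2)[of w] by linarith
qed

lemma form_nonneg: "form w w \<ge> 0"
proof -
  have "0 \<le> (\<sigma>1 + 1 - real p) * sq1 w" "0 \<le> (\<sigma>2 + 1 - real q) * sq2 w"
    using \<sigma>1 \<sigma>2 by (simp_all add: mult_nonneg_nonneg)
  then have "0 \<le> \<beta> * ((\<sigma>1 + 1) * sq1 w - (norm (sum1 w))\<^sup>2)"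
    "0 \<le> \<beta> * ((\<sigma>2 + 1) * sq2 w - \<tau> * (norm (sum2 w))\<^sup>2)"
    using \<beta> sum_bounds(1)[of w] sum2_bound[of w] by (simp_all add: mult_nonneg_nonneg)
  then show ?thesis
    unfolding form_self using \<beta> step(3) by simp
qed

text \<open>The square with factor \<open>1 - s\<close> is dropped; since \<open>\<tau> < 1\<close>,
  the last term of \<open>gap_eq\<close> controls the multiplier.\<close>

lemma gap_lower:
  "\<beta> * (\<sigma>1 + 1 - real p) * sq1 w + \<beta> * (\<sigma>2 + 1 - real q) * sq2 w + (1 - \<tau>) / \<beta> * sq3 w
     \<le> 2 * form w (corr w) - form (corr w) (corr w)"
proof -
  have "0 \<le> (1 - s) / \<beta> * (norm (snd (snd w) - \<beta> *\<^sub>R sum2 w))\<^sup>2"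
    using \<beta> step(2) by simp
  then show ?thesis
    unfolding gap_eq
    using mult_left_mono[OF sum_bounds(1)[of w] less_imp_le[OF \<beta>], folded mult.assoc]
      mult_left_mono[OF sum_bounds(2)[of w] less_imp_le[OF \<beta>], folded mult.assoc]
    by linarith
qed

lemma form_corr_lower:
  "\<beta> * (\<sigma>1 + 1 - real p) * sq1 w + \<beta> * (\<sigma>2 + 1 - real q) * sq2 w
     + (\<tau> + s) / \<beta> * (norm (snd (snd w) - \<beta> *\<^sub>R sum2 w))\<^sup>2 \<le> form (corr w) (corr w)"
  unfolding form_corr_self
  using mult_left_mono[OF sum_bounds(1)[of w] less_imp_le[OF \<beta>], folded mult.assoc]
    mult_left_mono[OF sum2_bound[of w] less_imp_le[OF \<beta>], folded mult.assoc]
  by linarith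

lemma form_corr_upper:
  "form (corr w) (corr w) \<le> \<beta> * (\<sigma>1 + 1) * sq1 w
     + (\<beta> * (\<sigma>2 + 1 + \<bar>\<tau>\<bar> * real q) + 2 * (\<tau> + s) * \<beta> * real q) * sq2 w + 2 * (\<tau> + s) / \<beta> * sq3 w"
proof -
  have 1: "(norm (snd (snd w) - \<beta> *\<^sub>R sum2 w))\<^sup>2 \<le> 2 * sq3 w + 2 * \<beta>\<^sup>2 * (real q * sq2 w)"
    using norm_add_squared_le[of "snd (snd w)" "- (\<beta> *\<^sub>R sum2 w)"]
      mult_left_mono[OF sum2_le[of w], of "\<beta>\<^sup>2"]
    by (simp add: sq3_def power_mult_distrib)
  have "(\<tau> + s) / \<beta> * (norm (snd (snd w) - \<beta> *\<^sub>R sum2 w))\<^sup>2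
      \<le> (\<tau> + s) / \<beta> * (2 * sq3 w + 2 * \<beta>\<^sup>2 * (real q * sq2 w))"
    using 1 \<beta> step(3) by (intro mult_left_mono) auto
  also have "\<dots> = 2 * (\<tau> + s) / \<beta> * sq3 w + 2 * (\<tau> + s) * \<beta> * real q * sq2 w"
    using \<beta> by (simp add: field_simps power2_eq_square)
  finally have 2: "(\<tau> + s) / \<beta> * (norm (snd (snd w) - \<beta> *\<^sub>R sum2 w))\<^sup>2 \<le> \<dots>" .
  \<comment> \<open>\<open>\<tau>\<close> may be negative, hence the absolute value.\<close>
  have "- (\<tau> * (norm (sum2 w))\<^sup>2) \<le> \<bar>\<tau>\<bar> * (norm (sum2 w))\<^sup>2"
    by (metis abs_ge_minus_self mult_minus_left mult_right_mono zero_le_power2)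
  also have "\<dots> \<le> \<bar>\<tau>\<bar> * (real q * sq2 w)"
    by (intro mult_left_mono sum2_le) simp
  finally have "(\<sigma>2 + 1) * sq2 w - \<tau> * (norm (sum2 w))\<^sup>2 \<le> (\<sigma>2 + 1 + \<bar>\<tau>\<bar> * real q) * sq2 w"
    by (simp add: algebra_simps)
  then have "\<beta> * ((\<sigma>2 + 1) * sq2 w - \<tau> * (norm (sum2 w))\<^sup>2) \<le> \<beta> * ((\<sigma>2 + 1 + \<bar>\<tau>\<bar> * real q) * sq2 w)"
    using \<beta> by simp
  moreover have "\<beta> * ((\<sigma>1 + 1) * sq1 w - (norm (sum1 w))\<^sup>2) \<le> \<beta> * ((\<sigma>1 + 1) * sq1 w)"
    using \<beta> by simp
  ultimately show ?thesis
    unfolding form_corr_self using 2 by (simp add: distrib_right mult.assoc)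
qed

text \<open>The sum of the three ratios is a crude common bound for all of them.\<close>

lemma weighted_sum_le:
  fixes x y z :: real
  assumes "x \<ge> 0" "y \<ge> 0" "z \<ge> 0" "a > 0" "b > 0" "c > 0" "a' \<ge> 0" "b' \<ge> 0" "c' \<ge> 0"
  shows "a' * x + b' * y + c' * z \<le> (a' / a + b' / b + c' / c) * (a * x + b * y + c * z)"
proof -
  have "a' * x \<le> a' / a * (a * x + b * y + c * z)" "b' * y \<le> b' / b * (a * x + b * y + c * z)"
    "c' * z \<le> c' / c * (a * x + b * y + c * z)"
    using assms by (simp_all add: field_simps)
  then show ?thesis
    by (simp add: distrib_right)
qed

text \<open>Both quadratic forms are compared with \<open>sq1\<close>, \<open>sq2\<close>,
  \<open>sq3\<close>: by \<open>form_corr_upper\<close> on one side, by \<open>gap_lower\<close> on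
  the other. This yields hypothesis \<open>C\<close> of
  \<open>prediction_correction_rate\<close>.\<close>

lemma form_corr_le_gap:
  "\<exists>C>0. \<forall>w :: 'v::real_inner state.
     form (corr w) (corr w) \<le> C * (2 * form w (corr w) - form (corr w) (corr w))"
proof -
  define a b c where "a = \<beta> * (\<sigma>1 + 1 - real p)" and "b = \<beta> * (\<sigma>2 + 1 - real q)" and "c = (1 - \<tau>) / \<beta>"
  define a' b' c' where "a' = \<beta> * (\<sigma>1 + 1)"
    and "b' = \<beta> * (\<sigma>2 + 1 + \<bar>\<tau>\<bar> * real q) + 2 * (\<tau> + s) * \<beta> * real q" and "c' = 2 * (\<tau> + s) / \<beta>"
  have pos: "a > 0" "b > 0" "c > 0" "a' > 0" "b' \<ge> 0" "c' > 0"
    using \<beta> \<sigma>1 \<sigma>2 step pq by (auto simp: a_def b_def c_def a'_def b'_def c'_def)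
  have C: "a' / a + b' / b + c' / c > 0"
    using pos by (simp add: add_pos_nonneg)
  have "form (corr w) (corr w) \<le> (a' / a + b' / b + c' / c) * (2 * form w (corr w) - form (corr w) (corr w))"
    for w :: "'v state"
  proof -
    have "form (corr w) (corr w) \<le> a' * sq1 w + b' * sq2 w + c' * sq3 w"
      using form_corr_upper[of w] by (simp add: a'_def b'_def c'_def)
    also have "\<dots> \<le> (a' / a + b' / b + c' / c) * (a * sq1 w + b * sq2 w + c * sq3 w)"
      using pos by (intro weighted_sum_le) auto
    also have "\<dots> \<le> (a' / a + b' / b + c' / c) * (2 * form w (corr w) - form (corr w) (corr w))"
      using gap_lower[of w] C by (intro mult_left_mono) (auto simp: a_def b_def c_def)
    finally show ?thesis .
  qed
  then show ?thesis
    using C by blast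
qed

text \<open>Turns a rate for \<open>form (corr w) (corr w)\<close> into one for the errors
  themselves.\<close>

lemma sq_le_form_corr:
  "\<exists>C>0. \<forall>w :: 'v::real_inner state. sq1 w + sq2 w + sq3 w \<le> C * form (corr w) (corr w)"
proof -
  define a b c where "a = \<beta> * (\<sigma>1 + 1 - real p)" and "b = \<beta> * (\<sigma>2 + 1 - real q)" and "c = (\<tau> + s) / \<beta>"
  \<comment> \<open>The 1 belongs to \<open>sq2\<close> itself; the rest pays for the second part
    when the multiplier is split into \<open>snd (snd w) - \<beta> *\<^sub>R sum2 w\<close> and
    \<open>\<beta> *\<^sub>R sum2 w\<close>.\<close>
  define b' where "b' = 1 + 2 * \<beta>\<^sup>2 * real q"
  have pos: "a > 0" "b > 0" "c > 0" "b' \<ge> 0"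
    using \<beta> \<sigma>1 \<sigma>2 step by (auto simp: a_def b_def c_def b'_def)
  have C: "1 / a + b' / b + 2 / c > 0"
    using pos by (simp add: add_pos_nonneg)
  have "sq1 w + sq2 w + sq3 w \<le> (1 / a + b' / b + 2 / c) * form (corr w) (corr w)" for w :: "'v state"
  proof -
    define r where "r = (norm (snd (snd w) - \<beta> *\<^sub>R sum2 w))\<^sup>2"
    have "sq3 w \<le> 2 * r + 2 * (\<beta>\<^sup>2 * (norm (sum2 w))\<^sup>2)"
      using norm_add_squared_le[of "snd (snd w) - \<beta> *\<^sub>R sum2 w" "\<beta> *\<^sub>R sum2 w"] \<beta>
      by (simp add: sq3_def r_def power_mult_distrib)
    also have "\<dots> \<le> 2 * r + 2 * (\<beta>\<^sup>2 * (real q * sq2 w))"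
      using sum2_le[of w] by (simp add: mult_left_mono)
    finally have "sq1 w + sq2 w + sq3 w \<le> 1 * sq1 w + b' * sq2 w + 2 * r"
      by (simp add: b'_def algebra_simps)
    also have "\<dots> \<le> (1 / a + b' / b + 2 / c) * (a * sq1 w + b * sq2 w + c * r)"
      using pos by (intro weighted_sum_le) (auto simp: r_def)
    also have "\<dots> \<le> (1 / a + b' / b + 2 / c) * form (corr w) (corr w)"
      using form_corr_lower[of w] C by (intro mult_left_mono) (auto simp: a_def b_def c_def r_def)
    finally show ?thesis .
  qed
  then show ?thesis
    using C by blast
qed

text \<open>By \<open>res\<close> the multiplier row of Q applied to \<open>w\<close> is
  \<open>sum1 v + sum2 v\<close>, so its contribution distributes over the blocks and the form
  becomes the sum of the products in \<open>1\<close> and \<open>2\<close>. This serves both for a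
  prediction against a solution and for two consecutive predictions.\<close>

lemma form_corr_nonneg:
  assumes res: "sum1 v + sum2 v = snd (snd w) /\<^sub>R \<beta> - sum2 w"
    and 1: "\<And>i. i \<in> {1..p} \<Longrightarrow>
      0 \<le> fst v i \<bullet> (\<beta> *\<^sub>R ((\<sigma>1 + 1) *\<^sub>R fst w i - sum1 w) + snd (snd v))"
    and 2: "\<And>j. j \<in> {1..q} \<Longrightarrow>
      0 \<le> fst (snd v) j \<bullet> (((\<sigma>2 + 1) * \<beta>) *\<^sub>R fst (snd w) j - \<tau> *\<^sub>R snd (snd w) + snd (snd v))"
  shows "form v (corr w) \<ge> 0"
proof -
  have "form v (corr w)
      = (\<Sum>i=1..p. fst v i \<bullet> (\<beta> *\<^sub>R ((\<sigma>1 + 1) *\<^sub>R fst w i - sum1 w) + snd (snd v)))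
      + (\<Sum>j=1..q. fst (snd v) j \<bullet> (((\<sigma>2 + 1) * \<beta>) *\<^sub>R fst (snd w) j - \<tau> *\<^sub>R snd (snd w) + snd (snd v)))"
  proof -
    have "(\<Sum>i=1..p. fst v i \<bullet> (\<beta> *\<^sub>R ((\<sigma>1 + 1) *\<^sub>R fst w i - sum1 w) + snd (snd v)))
        = \<beta> * ((\<sigma>1 + 1) * (\<Sum>i=1..p. fst v i \<bullet> fst w i) - sum1 v \<bullet> sum1 w) + sum1 v \<bullet> snd (snd v)"
      by (simp add: inner_add_right inner_diff_right sum.distrib sum_subtractf sum_distrib_left
          sum1_def[of v] inner_sum_left right_diff_distrib)
    moreover have "(\<Sum>j=1..q. fst (snd v) j \<bullet>
          (((\<sigma>2 + 1) * \<beta>) *\<^sub>R fst (snd w) j - \<tau> *\<^sub>R snd (snd w) + snd (snd v)))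
        = (\<sigma>2 + 1) * \<beta> * (\<Sum>j=1..q. fst (snd v) j \<bullet> fst (snd w) j) - \<tau> * (sum2 v \<bullet> snd (snd w))
          + sum2 v \<bullet> snd (snd v)"
      by (simp add: inner_add_right inner_diff_right sum.distrib sum_subtractf sum_distrib_left
          sum2_def[of v] inner_sum_left right_diff_distrib)
    moreover have "snd (snd v) \<bullet> (snd (snd w) /\<^sub>R \<beta> - sum2 w) = sum1 v \<bullet> snd (snd v) + sum2 v \<bullet> snd (snd v)"
      by (simp add: res[symmetric] inner_add_right inner_commute)
    ultimately show ?thesis
      unfolding form_corr by linarith
  qed
  moreover have "\<dots> \<ge> 0"
    using 1 2 by (intro add_nonneg_nonneg sum_nonneg) auto
  ultimately show ?thesis
    by simp
qed

end

section \<open>Optimality of the subproblems and convergence rate\<close>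

text \<open>Divide by \<open>t\<close> and let it tend to 0.\<close>

lemma nonneg_of_quadratic_nonneg:
  fixes D c :: real
  assumes "\<And>t. 0 < t \<Longrightarrow> t \<le> 1 \<Longrightarrow> 0 \<le> t * D + t\<^sup>2 * c"
  shows "D \<ge> 0"
proof (rule field_le_epsilon)
  fix e :: real assume e: "e > 0"
  define t where "t = min 1 (e / (\<bar>c\<bar> + 1))"
  have t: "0 < t" "t \<le> 1"
    using e by (auto simp: t_def)
  have "t * \<bar>c\<bar> \<le> e / (\<bar>c\<bar> + 1) * \<bar>c\<bar>"
    by (intro mult_right_mono) (auto simp: t_def)
  also have "\<dots> \<le> e"
    using e by (simp add: field_simps)
  finally have "t * c \<le> e"
    using t(1) mult_left_mono[OF abs_ge_self, of t c] by linarith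
  moreover have "0 \<le> t * (D + t * c)"
    using assms[OF t] by (simp add: power2_eq_square algebra_simps)
  then have "0 \<le> D + t * c"
    using t(1) by (simp add: zero_le_mult_iff)
  ultimately show "0 \<le> D + e"
    by linarith
qed

text \<open>Compare \<open>x\<close> with the points of the segment to \<open>z\<close>: convexity
  bounds \<open>f\<close> there linearly in \<open>t\<close>, the quadratic terms expand exactly,
  and the first-order part in \<open>t\<close> must be nonnegative. The factor
  \<open>\<sigma> + 1\<close> collects the penalty and the proximal term.\<close>

lemma proximal_step_optimality:
  fixes M :: "real ^ 'm::finite ^ 'n::finite"
  assumes S: "convex S" and f: "convex_on S f" and x: "x \<in> S" and z: "z \<in> S"
    and min: "\<And>u. u \<in> S \<Longrightarrow>
      f x - l \<bullet> (r + M *v (x - x0)) + \<beta> / 2 * (norm (r + M *v (x - x0)))\<^sup>2 + \<sigma> * \<beta> / 2 * (norm (M *v (x - x0)))\<^sup>2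
      \<le> f u - l \<bullet> (r + M *v (u - x0)) + \<beta> / 2 * (norm (r + M *v (u - x0)))\<^sup>2 + \<sigma> * \<beta> / 2 * (norm (M *v (u - x0)))\<^sup>2"
  shows "f x + (l - \<beta> *\<^sub>R r - ((\<sigma> + 1) * \<beta>) *\<^sub>R (M *v (x - x0))) \<bullet> (M *v (z - x)) \<le> f z"
proof -
  define a d where "a = M *v (x - x0)" and "d = M *v (z - x)"
  define v where "v = l - \<beta> *\<^sub>R r - ((\<sigma> + 1) * \<beta>) *\<^sub>R a"
  have "0 \<le> t * (f z - f x - v \<bullet> d) + t\<^sup>2 * ((\<sigma> + 1) * \<beta> / 2 * (norm d)\<^sup>2)" if t: "0 < t" "t \<le> 1" for t
  proof -
    define u where "u = (1 - t) *\<^sub>R x + t *\<^sub>R z"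
    have u: "u \<in> S"
      unfolding u_def using S x z t by (intro convexD_alt) auto
    have "u - x0 = (x - x0) + t *\<^sub>R (z - x)"
      by (simp add: u_def algebra_simps)
    then have Mu: "M *v (u - x0) = a + t *\<^sub>R d"
      by (simp only: a_def d_def matrix_vector_right_distrib matrix_vector_mult_scaleR)
    have sq: "(norm (b + t *\<^sub>R d))\<^sup>2 = (norm b)\<^sup>2 + 2 * t * (b \<bullet> d) + t\<^sup>2 * (norm d)\<^sup>2" for b
      unfolding power2_norm_eq_inner
      by (simp add: inner_add_left inner_add_right inner_commute power2_eq_square algebra_simps)
    have fu: "f u \<le> (1 - t) * f x + t * f z"
      unfolding u_def using convex_onD[OF f, of t x z] t x z by simp
    have "f x - l \<bullet> (r + a) + \<beta> / 2 * (norm (r + a))\<^sup>2 + \<sigma> * \<beta> / 2 * (norm a)\<^sup>2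
        \<le> f u - l \<bullet> ((r + a) + t *\<^sub>R d) + \<beta> / 2 * (norm ((r + a) + t *\<^sub>R d))\<^sup>2
          + \<sigma> * \<beta> / 2 * (norm (a + t *\<^sub>R d))\<^sup>2"
      using min[OF u] by (simp add: Mu a_def[symmetric] add.assoc)
    also have "\<dots> = f u - l \<bullet> (r + a) + \<beta> / 2 * (norm (r + a))\<^sup>2 + \<sigma> * \<beta> / 2 * (norm a)\<^sup>2
        - t * (v \<bullet> d) + t\<^sup>2 * ((\<sigma> + 1) * \<beta> / 2 * (norm d)\<^sup>2)"
      unfolding sq v_def
      by (simp add: inner_add_left inner_add_right inner_diff_left inner_diff_right field_simps)
    finally show ?thesis
      using fu by (simp add: algebra_simps)
  qed
  then have "f z - f x - v \<bullet> d \<ge> 0"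
    by (rule nonneg_of_quadratic_nonneg)
  then show ?thesis
    by (simp add: v_def a_def d_def)
qed

lemma coord_proj_inner: "x \<in> coord_space I \<Longrightarrow> coord_proj I v \<bullet> x = v \<bullet> x"
  unfolding coord_proj_def coord_space_def inner_vec_def by (auto intro!: sum.cong)

lemma subspace_coord_space: "subspace (coord_space I)"
  by (auto simp: subspace_def coord_space_def)

text \<open>By \<open>opt\<close>, \<open>x\<close> minimises over \<open>S\<close> the sum of
  \<open>f\<close> and the linear function given by \<open>- w\<close>, so the sum rule splits
  \<open>w\<close> into a subgradient and a normal vector. The subgradient is found in the ambient
  space and then projected; its products with differences of points of \<open>coord_space I\<close>
  stay the same.\<close>

lemma subdifferential_plus_normal_cone:
  fixes f :: "real ^ 'm::finite \<Rightarrow> real"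
  assumes f: "convex_on (coord_space I) f" and S: "convex S" "S \<subseteq> coord_space I"
    and x: "x \<in> S" and w: "w \<in> coord_space I"
    and opt: "\<And>z. z \<in> S \<Longrightarrow> f x + w \<bullet> (z - x) \<le> f z"
  shows "w \<in> subdifferential (coord_space I) f x + normal_cone (coord_space I) S x"
proof -
  note sub = subspace_coord_space[of I]
  define F where "F = (\<lambda>x. f (coord_proj I x))"
  \<comment> \<open>The epigraph over \<open>S\<close> of that linear function, normalised to vanish
    at \<open>x\<close>.\<close>
  define K where "K = {(u, t). u \<in> S \<and> w \<bullet> (x - u) \<le> t}"
  have F: "F u = f u" if "u \<in> coord_space I" for u
    using that by (simp add: F_def)
  have "convex_on UNIV F"
    unfolding F_def by (rule convex_on_coord_proj[OF f])
  moreover have "convex K"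
    unfolding convex_alt K_def
  proof (clarsimp, intro conjI)
    fix u r v t \<theta> assume *: "u \<in> S" "w \<bullet> (x - u) \<le> r" "v \<in> S" "w \<bullet> (x - v) \<le> t" "0 \<le> (\<theta>::real)" "\<theta> \<le> 1"
    show "(1 - \<theta>) *\<^sub>R u + \<theta> *\<^sub>R v \<in> S"
      using S(1) * by (intro convexD_alt) auto
    have "w \<bullet> (x - ((1 - \<theta>) *\<^sub>R u + \<theta> *\<^sub>R v)) = (1 - \<theta>) * (w \<bullet> (x - u)) + \<theta> * (w \<bullet> (x - v))"
      by (simp add: inner_add_right inner_diff_right algebra_simps)
    also have "\<dots> \<le> (1 - \<theta>) * r + \<theta> * t"
      using * by (intro add_mono mult_left_mono) auto
    finally show "w \<bullet> (x - ((1 - \<theta>) *\<^sub>R u + \<theta> *\<^sub>R v)) \<le> (1 - \<theta>) * r + \<theta> * t" .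
  qed
  moreover have "(x, 0) \<in> K"
    using x by (simp add: K_def)
  moreover have "F x + 0 \<le> F u + t" if "(u, t) \<in> K" for u t
    using that opt[of u] S(2) x by (auto simp: K_def F subsetD inner_diff_right)
  ultimately obtain v where v: "\<And>u. F x + v \<bullet> (u - x) \<le> F u" "\<And>u t. (u, t) \<in> K \<Longrightarrow> 0 \<le> v \<bullet> (u - x) + t"
    using convex_sum_minimizer_subgradient[of F K x 0] by blast
  have xV: "x \<in> coord_space I"
    using S(2) x by blast
  have inner: "coord_proj I v \<bullet> (z - x) = v \<bullet> (z - x)" if "z \<in> coord_space I" for z
    using that xV by (intro coord_proj_inner subspace_diff[OF sub])
  have "f x + coord_proj I v \<bullet> (z - x) \<le> f z" if "z \<in> coord_space I" for z
    using v(1)[of z] inner[OF that] F[OF that] F[OF xV] by simp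
  then have "coord_proj I v \<in> subdifferential (coord_space I) f x"
    by (simp add: subdifferential_def)
  moreover have "w - coord_proj I v \<in> normal_cone (coord_space I) S x"
  proof -
    have "(w - coord_proj I v) \<bullet> (z - x) \<le> 0" if z: "z \<in> S" for z
    proof -
      have "0 \<le> v \<bullet> (z - x) + w \<bullet> (x - z)"
        using z by (intro v(2)) (simp add: K_def)
      moreover have "coord_proj I v \<bullet> (z - x) = v \<bullet> (z - x)"
        using inner S(2) z by blast
      ultimately show ?thesis
        by (simp add: inner_diff_left inner_diff_right)
    qed
    then show ?thesis
      using x w by (simp add: normal_cone_def subspace_diff[OF sub])
  qed
  ultimately have "coord_proj I v + (w - coord_proj I v)
      \<in> subdifferential (coord_space I) f x + normal_cone (coord_space I) S x"
    by (rule set_plus_intro)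
  then show ?thesis
    by simp
qed

lemma objective_upd_left:
  "i \<in> {1..p} \<Longrightarrow> objective p q f g (x(i := u)) y = objective p q f g x y + (f i u - f i (x i))"
  using sum_fun_upd[of "{1..p}" i f x u] by (simp add: objective_def)

lemma objective_upd_right:
  "j \<in> {1..q} \<Longrightarrow> objective p q f g x (y(j := u)) = objective p q f g x y + (g j u - g j (y j))"
  using sum_fun_upd[of "{1..q}" j g y u] by (simp add: objective_def)

lemma inner_transpose_mult:
  fixes M :: "real ^ 'm::finite ^ 'n::finite"
  shows "(transpose M *v u) \<bullet> v = u \<bullet> (M *v v)"
  by (simp only: transpose_matrix_vector dot_lmul_matrix)

lemma uniform_bound_transposes:
  fixes M :: "nat \<Rightarrow> real ^ 'm::finite ^ 'n::finite"
  obtains K where "K \<ge> 0" "\<And>i u. i \<in> {1..p} \<Longrightarrow> (norm (transpose (M i) *v u))\<^sup>2 \<le> K * (norm u)\<^sup>2"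
proof -
  define N where "N = (\<lambda>i. (onorm ((*v) (transpose (M i))))\<^sup>2)"
  show ?thesis
  proof (rule that[of "sum N {1..p}"])
    show "sum N {1..p} \<ge> 0"
      by (simp add: N_def sum_nonneg)
    show "(norm (transpose (M i) *v u))\<^sup>2 \<le> sum N {1..p} * (norm u)\<^sup>2" if "i \<in> {1..p}" for i u
    proof -
      have "(norm (transpose (M i) *v u))\<^sup>2 \<le> (onorm ((*v) (transpose (M i))) * norm u)\<^sup>2"
        by (intro power_mono onorm matrix_vector_mul_bounded_linear) simp
      also have "\<dots> = N i * (norm u)\<^sup>2"
        by (simp add: N_def power_mult_distrib)
      also have "\<dots> \<le> sum N {1..p} * (norm u)\<^sup>2"
        using that by (intro mult_right_mono member_le_sum) (auto simp: N_def)
      finally show ?thesis .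
    qed
  qed
qed

lemma norm_diff_squared_le:
  "(norm (x - y))\<^sup>2 \<le> 2 * (norm x)\<^sup>2 + 2 * (norm y)\<^sup>2"
  using norm_add_squared_le[of x "- y"] by simp

lemma norm_scaleR_diff_squared_le:
  "(norm (a *\<^sub>R x - b *\<^sub>R y))\<^sup>2 \<le> 2 * a\<^sup>2 * (norm x)\<^sup>2 + 2 * b\<^sup>2 * (norm y)\<^sup>2"
  using norm_diff_squared_le[of "a *\<^sub>R x" "b *\<^sub>R y"] by (simp add: power_mult_distrib)

section \<open>One run of GS-ADMM in the image variables\<close>

locale gs_admm_run = gs_params p q \<beta> \<sigma>1 \<sigma>2 \<tau> s
  for p q :: nat and \<beta> \<sigma>1 \<sigma>2 \<tau> s :: real +
  fixes I :: "nat \<Rightarrow> 'm::finite set" and J :: "nat \<Rightarrow> 'd::finite set"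
    and f :: "nat \<Rightarrow> real ^ 'm \<Rightarrow> real" and g :: "nat \<Rightarrow> real ^ 'd \<Rightarrow> real"
    and A :: "nat \<Rightarrow> real ^ 'm ^ 'n::finite" and B :: "nat \<Rightarrow> real ^ 'd ^ 'n" and c :: "real ^ 'n"
    and X :: "nat \<Rightarrow> (real ^ 'm) set" and Y :: "nat \<Rightarrow> (real ^ 'd) set"
    and x :: "nat \<Rightarrow> nat \<Rightarrow> real ^ 'm" and y :: "nat \<Rightarrow> nat \<Rightarrow> real ^ 'd" and lam :: "nat \<Rightarrow> real ^ 'n"
  assumes f: "\<And>i. i \<in> {1..p} \<Longrightarrow> convex_on (coord_space (I i)) (f i)"
    and g: "\<And>j. j \<in> {1..q} \<Longrightarrow> convex_on (coord_space (J j)) (g j)"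
    and A: "\<And>i. i \<in> {1..p} \<Longrightarrow> columns_in (I i) (A i)"
    and B: "\<And>j. j \<in> {1..q} \<Longrightarrow> columns_in (J j) (B j)"
    and X: "\<And>i. i \<in> {1..p} \<Longrightarrow> convex (X i) \<and> X i \<subseteq> coord_space (I i)"
    and Y: "\<And>j. j \<in> {1..q} \<Longrightarrow> convex (Y j) \<and> Y j \<subseteq> coord_space (J j)"
    and run: "gs_admm p q f g A B c X Y \<beta> \<sigma>1 \<sigma>2 \<tau> s x y lam"
begin

abbreviation res where "res \<equiv> residual p q A B c"

abbreviation lamt where "lamt \<equiv> lam_tilde p q A B c \<beta> x y lam"

definition iter :: "nat \<Rightarrow> (real ^ 'n) state" where
  "iter k = (\<lambda>i. A i *v x k i, \<lambda>j. B j *v y k j, lam k)"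

definition err :: "nat \<Rightarrow> (real ^ 'n) state" where
  "err k = (\<lambda>i. A i *v (x k i - x (Suc k) i), \<lambda>j. B j *v (y k j - y (Suc k) j), lam k - lamt k)"

text \<open>The transpose of \<open>A i\<close> maps this vector to the element of the optimality
  inclusion, that is, to the image of \<open>lamt k\<close> minus d_1i (see
  \<open>dual_res1_eq\<close>); \<open>dual2\<close> does the same for the y-blocks.\<close>

definition dual1 :: "nat \<Rightarrow> nat \<Rightarrow> real ^ 'n" where
  "dual1 k i = lamt k + \<beta> *\<^sub>R ((\<sigma>1 + 1) *\<^sub>R fst (err k) i - sum1 (err k))"

definition dual2 :: "nat \<Rightarrow> nat \<Rightarrow> real ^ 'n" where
  "dual2 k j = lamt k + ((\<sigma>2 + 1) * \<beta>) *\<^sub>R fst (snd (err k)) j - \<tau> *\<^sub>R snd (snd (err k))"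

lemma iter_minus_err:
  "iter k - err k = (\<lambda>i. A i *v x (Suc k) i, \<lambda>j. B j *v y (Suc k) j, lamt k)"
  by (simp add: iter_def err_def prod_eq_iff fun_eq_iff matrix_vector_mult_diff_distrib)

lemma res_x: "res (x k) (y k) = res (x (Suc k)) (y k) + sum1 (err k)"
  by (simp add: residual_def sum1_def err_def matrix_vector_mult_diff_distrib sum_subtractf)

lemma res_y: "res (x (Suc k)) (y (Suc k)) = res (x (Suc k)) (y k) - sum2 (err k)"
  by (simp add: residual_def sum2_def err_def matrix_vector_mult_diff_distrib sum_subtractf)

lemma lamt_eq: "lam k - lamt k = \<beta> *\<^sub>R res (x (Suc k)) (y k)"
  by (simp add: lam_tilde_def)

text \<open>The residual at the new iterate is the multiplier row of Q applied to the error; so it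
  both feeds the abstract scheme and inherits the rate.\<close>

lemma res_err: "res (x (Suc k)) (y (Suc k)) = snd (snd (err k)) /\<^sub>R \<beta> - sum2 (err k)"
  using \<beta> by (simp add: res_y err_def lamt_eq)

text \<open>The two multiplier updates combine: by \<open>lamt_eq\<close> the first residual is a
  multiple of \<open>lam k - lamt k\<close>, and by \<open>res_y\<close> the second differs from it
  by \<open>sum2 (err k)\<close>.\<close>

lemma iter_step: "iter (Suc k) = iter k - corr (err k)"
proof -
  have "lam (Suc k) = lam k - (\<tau> * \<beta>) *\<^sub>R res (x (Suc k)) (y k) - (s * \<beta>) *\<^sub>R res (x (Suc k)) (y (Suc k))"
    using run by (simp add: gs_admm_def half_multiplier_def)
  also have "\<dots> = lam k - ((\<tau> + s) *\<^sub>R (lam k - lamt k) - (s * \<beta>) *\<^sub>R sum2 (err k))"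
    unfolding res_y lamt_eq by (simp add: algebra_simps)
  finally show ?thesis
    by (simp add: iter_def err_def corr_def prod_eq_iff fun_eq_iff matrix_vector_mult_diff_distrib)
qed

lemma x_in: "i \<in> {1..p} \<Longrightarrow> x (Suc k) i \<in> X i"
  using run by (simp add: gs_admm_def is_arg_min_def)

lemma y_in: "j \<in> {1..q} \<Longrightarrow> y (Suc k) j \<in> Y j"
  using run by (simp add: gs_admm_def is_arg_min_def)

lemma x_optimality:
  assumes i: "i \<in> {1..p}" and z: "z \<in> X i"
  shows "f i (x (Suc k) i) + dual1 k i \<bullet> (A i *v (z - x (Suc k) i)) \<le> f i z"
proof -
  have "f i (x (Suc k) i) + (lam k - \<beta> *\<^sub>R res (x k) (y k)
      - ((\<sigma>1 + 1) * \<beta>) *\<^sub>R (A i *v (x (Suc k) i - x k i))) \<bullet> (A i *v (z - x (Suc k) i)) \<le> f i z"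
  proof (rule proximal_step_optimality)
    show "convex (X i)" "convex_on (X i) (f i)"
      using X[OF i] f[OF i] by (auto intro: convex_on_subset)
    fix u assume u: "u \<in> X i"
    define L where "L = (\<lambda>u. aug_lagrangian p q f g A B c \<beta> ((x k)(i := u)) (y k) (lam k)
        + \<sigma>1 * \<beta> / 2 * (norm (A i *v (u - x k i)))\<^sup>2)"
    have "L (x (Suc k) i) \<le> L u"
      using run i u unfolding gs_admm_def is_arg_min_def L_def[symmetric] by (simp add: L_def not_less)
    then show "f i (x (Suc k) i) - lam k \<bullet> (res (x k) (y k) + A i *v (x (Suc k) i - x k i))
        + \<beta> / 2 * (norm (res (x k) (y k) + A i *v (x (Suc k) i - x k i)))\<^sup>2
        + \<sigma>1 * \<beta> / 2 * (norm (A i *v (x (Suc k) i - x k i)))\<^sup>2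
        \<le> f i u - lam k \<bullet> (res (x k) (y k) + A i *v (u - x k i))
        + \<beta> / 2 * (norm (res (x k) (y k) + A i *v (u - x k i)))\<^sup>2
        + \<sigma>1 * \<beta> / 2 * (norm (A i *v (u - x k i)))\<^sup>2"
      unfolding L_def aug_lagrangian_def objective_upd_left[OF i] residual_upd_left[OF i] by linarith
  qed (use x_in i z in auto)
  \<comment> \<open>All x-blocks are updated from iterate \<open>k\<close>, so the residual here is
    the old one; it differs from the one in \<open>lamt k\<close> by \<open>sum1 (err k)\<close>,
    the coupling term of \<open>dual1\<close>.\<close>
  moreover have "lam k - \<beta> *\<^sub>R res (x k) (y k) - ((\<sigma>1 + 1) * \<beta>) *\<^sub>R (A i *v (x (Suc k) i - x k i)) = dual1 k i"
  proof -
    have e: "A i *v (x (Suc k) i - x k i) = - fst (err k) i"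
      by (simp add: err_def matrix_vector_mult_diff_distrib)
    have l: "lam k = lamt k + \<beta> *\<^sub>R res (x (Suc k)) (y k)"
      by (simp add: lam_tilde_def)
    show ?thesis
      unfolding e dual1_def res_x l by (simp add: algebra_simps)
  qed
  ultimately show ?thesis
    by simp
qed

lemma y_optimality:
  assumes j: "j \<in> {1..q}" and z: "z \<in> Y j"
  shows "g j (y (Suc k) j) + dual2 k j \<bullet> (B j *v (z - y (Suc k) j)) \<le> g j z"
proof -
  define half where "half = half_multiplier p q A B c \<beta> \<tau> x y lam k"
  have "g j (y (Suc k) j) + (half - \<beta> *\<^sub>R res (x (Suc k)) (y k)
      - ((\<sigma>2 + 1) * \<beta>) *\<^sub>R (B j *v (y (Suc k) j - y k j))) \<bullet> (B j *v (z - y (Suc k) j)) \<le> g j z"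
  proof (rule proximal_step_optimality)
    show "convex (Y j)" "convex_on (Y j) (g j)"
      using Y[OF j] g[OF j] by (auto intro: convex_on_subset)
    fix u assume u: "u \<in> Y j"
    define L where "L = (\<lambda>u. aug_lagrangian p q f g A B c \<beta> (x (Suc k)) ((y k)(j := u)) half
        + \<sigma>2 * \<beta> / 2 * (norm (B j *v (u - y k j)))\<^sup>2)"
    have "L (y (Suc k) j) \<le> L u"
      using run j u unfolding gs_admm_def is_arg_min_def by (simp add: L_def half_def not_less)
    then show "g j (y (Suc k) j) - half \<bullet> (res (x (Suc k)) (y k) + B j *v (y (Suc k) j - y k j))
        + \<beta> / 2 * (norm (res (x (Suc k)) (y k) + B j *v (y (Suc k) j - y k j)))\<^sup>2
        + \<sigma>2 * \<beta> / 2 * (norm (B j *v (y (Suc k) j - y k j)))\<^sup>2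
        \<le> g j u - half \<bullet> (res (x (Suc k)) (y k) + B j *v (u - y k j))
        + \<beta> / 2 * (norm (res (x (Suc k)) (y k) + B j *v (u - y k j)))\<^sup>2
        + \<sigma>2 * \<beta> / 2 * (norm (B j *v (u - y k j)))\<^sup>2"
      unfolding L_def aug_lagrangian_def objective_upd_right[OF j] residual_upd_right[OF j] by linarith
  qed (use y_in j z in auto)
  \<comment> \<open>Subtracting the penalty term from the half-step multiplier leaves
    \<open>lamt k\<close> minus \<open>\<tau>\<close> times the multiplier error.\<close>
  moreover have "half - \<beta> *\<^sub>R res (x (Suc k)) (y k) - ((\<sigma>2 + 1) * \<beta>) *\<^sub>R (B j *v (y (Suc k) j - y k j)) = dual2 k j"
  proof -
    have e: "B j *v (y (Suc k) j - y k j) = - fst (snd (err k)) j"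
      by (simp add: err_def matrix_vector_mult_diff_distrib)
    have m: "snd (snd (err k)) = \<beta> *\<^sub>R res (x (Suc k)) (y k)"
      by (simp add: err_def lamt_eq)
    have h: "half = lamt k + \<beta> *\<^sub>R res (x (Suc k)) (y k) - (\<tau> * \<beta>) *\<^sub>R res (x (Suc k)) (y k)"
      by (simp add: half_def half_multiplier_def lam_tilde_def)
    show ?thesis
      unfolding e m h dual2_def by (simp add: algebra_simps)
  qed
  ultimately show ?thesis
    by simp
qed

text \<open>Both variants of d_1i factor through the transpose of \<open>A i\<close> with a vector
  linear in \<open>err k\<close>, so both inherit the rate; the first is tied to
  \<open>dual1\<close>, which yields the inclusion.\<close>

lemma dual_res1_eq:
  assumes "i \<in> {1..p}"
  shows "dual_res1 p A \<beta> \<sigma>1 (x (Suc k)) (x k) i = transpose (A i) *v (lamt k - dual1 k i)"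
    and "dual_res1_sum p A \<beta> \<sigma>1 (x (Suc k)) (x k) i
      = transpose (A i) *v ((\<beta> * (1 - \<sigma>1)) *\<^sub>R sum1 (err k) - \<beta> *\<^sub>R fst (err k) i)"
proof -
  have neg: "A l *v (x (Suc k) l - x k l) = - fst (err k) l" for l
    by (simp add: err_def matrix_vector_mult_diff_distrib)
  have S: "(\<Sum>l=1..p. - fst (err k) l) = - sum1 (err k)"
    by (simp add: sum1_def sum_negf)
  have S': "(\<Sum>l\<in>{1..p} - {i}. - fst (err k) l) = fst (err k) i - sum1 (err k)"
    using assms by (simp add: sum1_def sum_negf sum.remove)
  define T where "T = (*v) (transpose (A i))"
  have lin: "linear T"
    unfolding T_def by (rule matrix_vector_mul_linear)
  note T = linear_diff[OF lin] linear_add[OF lin] linear_neg[OF lin] linear_scale[OF lin]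
  show "dual_res1 p A \<beta> \<sigma>1 (x (Suc k)) (x k) i = transpose (A i) *v (lamt k - dual1 k i)"
    unfolding dual_res1_def dual1_def neg S' T_def[symmetric]
    by (simp add: T algebra_simps)
  show "dual_res1_sum p A \<beta> \<sigma>1 (x (Suc k)) (x k) i
      = transpose (A i) *v ((\<beta> * (1 - \<sigma>1)) *\<^sub>R sum1 (err k) - \<beta> *\<^sub>R fst (err k) i)"
    unfolding dual_res1_sum_def neg S S' T_def[symmetric]
    by (simp add: T algebra_simps)
qed

lemma dual_res2_eq:
  "dual_res2 B \<beta> \<sigma>2 \<tau> (y (Suc k)) (y k) (lamt k) (lam k) j = transpose (B j) *v (lamt k - dual2 k j)"
proof -
  have neg: "B j *v (y (Suc k) j - y k j) = - fst (snd (err k)) j"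
    by (simp add: err_def matrix_vector_mult_diff_distrib)
  have l: "lamt k - lam k = - snd (snd (err k))"
    by (simp add: err_def)
  define T where "T = (*v) (transpose (B j))"
  have lin: "linear T"
    unfolding T_def by (rule matrix_vector_mul_linear)
  note T = linear_diff[OF lin] linear_add[OF lin] linear_neg[OF lin] linear_scale[OF lin]
  show ?thesis
    unfolding dual_res2_def dual2_def neg l T_def[symmetric]
    by (simp add: T algebra_simps)
qed

lemma inclusion1:
  assumes i: "i \<in> {1..p}"
  shows "transpose (A i) *v lamt k - dual_res1 p A \<beta> \<sigma>1 (x (Suc k)) (x k) i
    \<in> subdifferential (coord_space (I i)) (f i) (x (Suc k) i)
      + normal_cone (coord_space (I i)) (X i) (x (Suc k) i)"
proof -
  have "transpose (A i) *v dual1 k i \<in> subdifferential (coord_space (I i)) (f i) (x (Suc k) i)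
      + normal_cone (coord_space (I i)) (X i) (x (Suc k) i)"
    using f[OF i] X[OF i] x_in[OF i] A[OF i] x_optimality[OF i]
    by (intro subdifferential_plus_normal_cone)
      (auto simp: inner_transpose_mult transpose_mult_in_coord_space simp del: transpose_matrix_vector)
  then show ?thesis
    by (simp add: dual_res1_eq[OF i] flip: matrix_vector_mult_diff_distrib del: transpose_matrix_vector)
qed

lemma inclusion2:
  assumes j: "j \<in> {1..q}"
  shows "transpose (B j) *v lamt k - dual_res2 B \<beta> \<sigma>2 \<tau> (y (Suc k)) (y k) (lamt k) (lam k) j
    \<in> subdifferential (coord_space (J j)) (g j) (y (Suc k) j)
      + normal_cone (coord_space (J j)) (Y j) (y (Suc k) j)"
proof -
  have "transpose (B j) *v dual2 k j \<in> subdifferential (coord_space (J j)) (g j) (y (Suc k) j)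
      + normal_cone (coord_space (J j)) (Y j) (y (Suc k) j)"
    using g[OF j] Y[OF j] y_in[OF j] B[OF j] y_optimality[OF j]
    by (intro subdifferential_plus_normal_cone)
      (auto simp: inner_transpose_mult transpose_mult_in_coord_space simp del: transpose_matrix_vector)
  then show ?thesis
    by (simp add: dual_res2_eq flip: matrix_vector_mult_diff_distrib del: transpose_matrix_vector)
qed

text \<open>Adding the two inequalities gives the monotonicity of the optimality operator in one
  block.\<close>

lemma inner_dual_nonneg:
  fixes M :: "real ^ 'k::finite ^ 'n"
  assumes "F u + d \<bullet> (M *v (u' - u)) \<le> F u'" "F u' + d' \<bullet> (M *v (u - u')) \<le> F u"
  shows "0 \<le> (M *v u - M *v u') \<bullet> (d - d')"
  using assms by (simp add: matrix_vector_mult_diff_distrib inner_diff_left inner_diff_right inner_commute)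

text \<open>The two nonnegativity conditions of the abstract scheme are blockwise monotonicity: of a
  prediction against the saddle point \<open>ws\<close>, and of consecutive predictions against each
  other. Predictions consist of updated blocks, so they lie in the sets \<open>X i\<close> and
  \<open>Y j\<close>.\<close>

lemma rate:
  assumes KKT1: "\<And>i z. i \<in> {1..p} \<Longrightarrow> z \<in> X i \<Longrightarrow> f i (xs i) + ls \<bullet> (A i *v (z - xs i)) \<le> f i z"
    and KKT2: "\<And>j z. j \<in> {1..q} \<Longrightarrow> z \<in> Y j \<Longrightarrow> g j (ys j) + ls \<bullet> (B j *v (z - ys j)) \<le> g j z"
    and feas: "feasible p q A B c X Y xs ys"
    and C: "C > 0" "\<And>w :: (real ^ 'n) state.
      form (corr w) (corr w) \<le> C * (2 * form w (corr w) - form (corr w) (corr w))"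
  defines "ws \<equiv> (\<lambda>i. A i *v xs i, \<lambda>j. B j *v ys j, ls)"
  shows "(real t + 1) * form (corr (err t)) (corr (err t)) \<le> C * form (iter 0 - ws) (iter 0 - ws)"
proof (rule prediction_correction_rate[where w = iter and h = form and M = corr and e = err])
  have sums: "sum1 (iter k - err k) + sum2 (iter k - err k) - c = snd (snd (err k)) /\<^sub>R \<beta> - sum2 (err k)" for k
    by (simp only: iter_minus_err flip: res_err) (simp add: residual_def sum1_def sum2_def)
  have sums': "sum1 ws + sum2 ws - c = 0"
    using feas by (simp add: feasible_iff residual_def ws_def sum1_def sum2_def)
  show "form v w = form w v" for v w :: "(real ^ 'n) state"
    by (rule form_sym)
  show "0 \<le> form (iter k - err k - ws) (corr (err k))" for k
  proof (rule form_corr_nonneg)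
    show "sum1 (iter k - err k - ws) + sum2 (iter k - err k - ws) = snd (snd (err k)) /\<^sub>R \<beta> - sum2 (err k)"
      unfolding sum1_diff[of "iter k - err k" ws] sum2_diff[of "iter k - err k" ws]
      using sums[of k] sums' by (simp add: algebra_simps)
    show "0 \<le> fst (iter k - err k - ws) i
        \<bullet> (\<beta> *\<^sub>R ((\<sigma>1 + 1) *\<^sub>R fst (err k) i - sum1 (err k)) + snd (snd (iter k - err k - ws)))"
      if i: "i \<in> {1..p}" for i
    proof -
      have "xs i \<in> X i"
        using feas i by (simp add: feasible_def)
      then have "0 \<le> (A i *v x (Suc k) i - A i *v xs i) \<bullet> (dual1 k i - ls)"
        using x_optimality[OF i] KKT1[OF i x_in[OF i]] by (intro inner_dual_nonneg[where F = "f i"]) auto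
      then show ?thesis
        unfolding iter_minus_err by (simp add: ws_def dual1_def algebra_simps)
    qed
    show "0 \<le> fst (snd (iter k - err k - ws)) j
        \<bullet> (((\<sigma>2 + 1) * \<beta>) *\<^sub>R fst (snd (err k)) j - \<tau> *\<^sub>R snd (snd (err k)) + snd (snd (iter k - err k - ws)))"
      if j: "j \<in> {1..q}" for j
    proof -
      have "ys j \<in> Y j"
        using feas j by (simp add: feasible_def)
      then have "0 \<le> (B j *v y (Suc k) j - B j *v ys j) \<bullet> (dual2 k j - ls)"
        using y_optimality[OF j] KKT2[OF j y_in[OF j]] by (intro inner_dual_nonneg[where F = "g j"]) auto
      then show ?thesis
        unfolding iter_minus_err by (simp add: ws_def dual2_def algebra_simps)
    qed
  qed
  show "0 \<le> form (iter k - err k - (iter (Suc k) - err (Suc k))) (corr (err k - err (Suc k)))" for k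
  proof (rule form_corr_nonneg)
    show "sum1 (iter k - err k - (iter (Suc k) - err (Suc k))) + sum2 (iter k - err k - (iter (Suc k) - err (Suc k)))
        = snd (snd (err k - err (Suc k))) /\<^sub>R \<beta> - sum2 (err k - err (Suc k))"
      unfolding sum1_diff[of "iter k - err k" "iter (Suc k) - err (Suc k)"]
        sum2_diff[of "iter k - err k" "iter (Suc k) - err (Suc k)"]
      using sums[of k] sums[of "Suc k"] by (simp add: sum2_diff algebra_simps)
    show "0 \<le> fst (iter k - err k - (iter (Suc k) - err (Suc k))) i
        \<bullet> (\<beta> *\<^sub>R ((\<sigma>1 + 1) *\<^sub>R fst (err k - err (Suc k)) i - sum1 (err k - err (Suc k)))
          + snd (snd (iter k - err k - (iter (Suc k) - err (Suc k)))))"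
      if i: "i \<in> {1..p}" for i
    proof -
      have "0 \<le> (A i *v x (Suc k) i - A i *v x (Suc (Suc k)) i) \<bullet> (dual1 k i - dual1 (Suc k) i)"
        using x_optimality[OF i x_in[OF i]] by (intro inner_dual_nonneg[where F = "f i"]) auto
      then show ?thesis
        unfolding iter_minus_err by (simp add: dual1_def sum1_diff algebra_simps)
    qed
    show "0 \<le> fst (snd (iter k - err k - (iter (Suc k) - err (Suc k)))) j
        \<bullet> (((\<sigma>2 + 1) * \<beta>) *\<^sub>R fst (snd (err k - err (Suc k))) j - \<tau> *\<^sub>R snd (snd (err k - err (Suc k)))
          + snd (snd (iter k - err k - (iter (Suc k) - err (Suc k)))))"
      if j: "j \<in> {1..q}" for j
    proof -
      have "0 \<le> (B j *v y (Suc k) j - B j *v y (Suc (Suc k)) j) \<bullet> (dual2 k j - dual2 (Suc k) j)"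
        using y_optimality[OF j y_in[OF j]] by (intro inner_dual_nonneg[where F = "g j"]) auto
      then show ?thesis
        unfolding iter_minus_err by (simp add: dual2_def algebra_simps)
    qed
  qed
qed (use C in \<open>simp_all add: form_diff form_nonneg corr_diff iter_step\<close>)

section \<open>Bounds of the residuals by the squared error\<close>

definition sq_err :: "nat \<Rightarrow> real" where
  "sq_err k = sq1 (err k) + sq2 (err k) + sq3 (err k)"

lemma err_bounds:
  shows "i \<in> {1..p} \<Longrightarrow> (norm (fst (err k) i))\<^sup>2 \<le> sq_err k"
    and "j \<in> {1..q} \<Longrightarrow> (norm (fst (snd (err k)) j))\<^sup>2 \<le> sq_err k"
    and "(norm (snd (snd (err k))))\<^sup>2 \<le> sq_err k"
    and "(norm (sum1 (err k)))\<^sup>2 \<le> real p * sq_err k"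
    and "(norm (sum2 (err k)))\<^sup>2 \<le> real q * sq_err k"
proof -
  show "(norm (fst (err k) i))\<^sup>2 \<le> sq_err k" if "i \<in> {1..p}"
  proof -
    have "(norm (fst (err k) i))\<^sup>2 \<le> sq1 (err k)"
      unfolding sq1_def using that by (intro member_le_sum) auto
    then show ?thesis
      by (simp add: sq_err_def add_increasing2)
  qed
  show "(norm (fst (snd (err k)) j))\<^sup>2 \<le> sq_err k" if "j \<in> {1..q}"
  proof -
    have "(norm (fst (snd (err k)) j))\<^sup>2 \<le> sq2 (err k)"
      unfolding sq2_def using that by (intro member_le_sum) auto
    then show ?thesis
      by (simp add: sq_err_def add_increasing add_increasing2)
  qed
  show "(norm (snd (snd (err k))))\<^sup>2 \<le> sq_err k"
    by (simp add: sq_err_def sq3_def)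
  show "(norm (sum1 (err k)))\<^sup>2 \<le> real p * sq_err k"
    by (rule order_trans[OF sum1_le]) (simp add: sq_err_def mult_left_mono)
  show "(norm (sum2 (err k)))\<^sup>2 \<le> real q * sq_err k"
    by (rule order_trans[OF sum2_le]) (simp add: sq_err_def mult_left_mono)
qed

lemma combination_bound:
  assumes "(norm u)\<^sup>2 \<le> m * sq_err k" "(norm v)\<^sup>2 \<le> n * sq_err k"
  shows "(norm (a *\<^sub>R u - b *\<^sub>R v))\<^sup>2 \<le> (2 * a\<^sup>2 * m + 2 * b\<^sup>2 * n) * sq_err k"
proof -
  have "2 * a\<^sup>2 * (norm u)\<^sup>2 + 2 * b\<^sup>2 * (norm v)\<^sup>2 \<le> 2 * a\<^sup>2 * (m * sq_err k) + 2 * b\<^sup>2 * (n * sq_err k)"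
    using assms by (intro add_mono mult_left_mono) auto
  then show ?thesis
    using norm_scaleR_diff_squared_le[of a u b v] by (simp add: algebra_simps)
qed

lemma res_bound: "(norm (res (x (Suc k)) (y (Suc k))))\<^sup>2 \<le> (2 * (inverse \<beta>)\<^sup>2 + 2 * real q) * sq_err k"
  using combination_bound[of "snd (snd (err k))" 1 k "sum2 (err k)" "real q" "inverse \<beta>" 1] err_bounds(3,5)
  by (simp add: res_err)

text \<open>\<open>d1\<close> is kept general so that the bound covers both variants of
  d_1i.\<close>

lemma stacked_bound:
  assumes KA: "KA \<ge> 0" "\<And>i u. i \<in> {1..p} \<Longrightarrow> (norm (transpose (A i) *v u))\<^sup>2 \<le> KA * (norm u)\<^sup>2"
    and KB: "KB \<ge> 0" "\<And>j u. j \<in> {1..q} \<Longrightarrow> (norm (transpose (B j) *v u))\<^sup>2 \<le> KB * (norm u)\<^sup>2"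
    and d1: "\<And>i. i \<in> {1..p} \<Longrightarrow> d1 i = transpose (A i) *v u i \<and> (norm (u i))\<^sup>2 \<le> m * sq_err k"
  shows "(stacked_norm p q d1 (dual_res2 B \<beta> \<sigma>2 \<tau> (y (Suc k)) (y k) (lamt k) (lam k)))\<^sup>2
    \<le> (real p * (KA * m) + real q * (KB * (2 * \<tau>\<^sup>2 + 2 * ((\<sigma>2 + 1) * \<beta>)\<^sup>2))) * sq_err k"
proof -
  define d2 where "d2 = dual_res2 B \<beta> \<sigma>2 \<tau> (y (Suc k)) (y k) (lamt k) (lam k)"
  have "(norm (d1 i))\<^sup>2 \<le> KA * m * sq_err k" if "i \<in> {1..p}" for i
    using order_trans[OF KA(2)[OF that] mult_left_mono[OF _ KA(1)]] d1[OF that] by (simp add: mult.assoc)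
  then have "(\<Sum>i=1..p. (norm (d1 i))\<^sup>2) \<le> real p * (KA * m * sq_err k)"
    using sum_bounded_above[of "{1..p}" "\<lambda>i. (norm (d1 i))\<^sup>2" "KA * m * sq_err k"] by simp
  moreover have "(norm (d2 j))\<^sup>2 \<le> KB * (2 * \<tau>\<^sup>2 + 2 * ((\<sigma>2 + 1) * \<beta>)\<^sup>2) * sq_err k" if j: "j \<in> {1..q}" for j
  proof -
    have "lamt k - dual2 k j = \<tau> *\<^sub>R snd (snd (err k)) - ((\<sigma>2 + 1) * \<beta>) *\<^sub>R fst (snd (err k)) j"
      by (simp add: dual2_def)
    then have "(norm (lamt k - dual2 k j))\<^sup>2 \<le> (2 * \<tau>\<^sup>2 + 2 * ((\<sigma>2 + 1) * \<beta>)\<^sup>2) * sq_err k"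
      using combination_bound[of "snd (snd (err k))" 1 k "fst (snd (err k)) j" 1] err_bounds(2)[OF j] err_bounds(3)
      by simp
    then show ?thesis
      using order_trans[OF KB(2)[OF j] mult_left_mono[OF _ KB(1)]]
      by (simp add: d2_def dual_res2_eq mult.assoc del: transpose_matrix_vector)
  qed
  then have "(\<Sum>j=1..q. (norm (d2 j))\<^sup>2) \<le> real q * (KB * (2 * \<tau>\<^sup>2 + 2 * ((\<sigma>2 + 1) * \<beta>)\<^sup>2) * sq_err k)"
    using sum_bounded_above[of "{1..q}" "\<lambda>j. (norm (d2 j))\<^sup>2"
        "KB * (2 * \<tau>\<^sup>2 + 2 * ((\<sigma>2 + 1) * \<beta>)\<^sup>2) * sq_err k"] by simp
  moreover have "(stacked_norm p q d1 d2)\<^sup>2 = (\<Sum>i=1..p. (norm (d1 i))\<^sup>2) + (\<Sum>j=1..q. (norm (d2 j))\<^sup>2)"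
    by (simp add: stacked_norm_def sum_nonneg)
  ultimately show ?thesis
    unfolding d2_def by (simp add: distrib_right mult.assoc)
qed

lemma dual1_bound:
  assumes "i \<in> {1..p}"
  shows "(norm (lamt k - dual1 k i))\<^sup>2 \<le> (2 * \<beta>\<^sup>2 * real p + 2 * (\<beta> * (\<sigma>1 + 1))\<^sup>2) * sq_err k"
proof -
  have "lamt k - dual1 k i = \<beta> *\<^sub>R sum1 (err k) - (\<beta> * (\<sigma>1 + 1)) *\<^sub>R fst (err k) i"
    by (simp add: dual1_def algebra_simps)
  then show ?thesis
    using combination_bound[of "sum1 (err k)" "real p" k "fst (err k) i" 1] err_bounds(1)[OF assms] err_bounds(4)
    by simp
qed

lemma dual1_sum_bound:
  assumes "i \<in> {1..p}"
  shows "(norm ((\<beta> * (1 - \<sigma>1)) *\<^sub>R sum1 (err k) - \<beta> *\<^sub>R fst (err k) i))\<^sup>2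
    \<le> (2 * (\<beta> * (1 - \<sigma>1))\<^sup>2 * real p + 2 * \<beta>\<^sup>2) * sq_err k"
  using combination_bound[of "sum1 (err k)" "real p" k "fst (err k) i" 1] err_bounds(1)[OF assms] err_bounds(4)
  by simp

end

section \<open>The rate with one constant for all runs\<close>

theorem theorem2p3:
  fixes p q :: nat
    and I :: "nat \<Rightarrow> 'm::finite set" and J :: "nat \<Rightarrow> 'd::finite set"
    and f :: "nat \<Rightarrow> real ^ 'm \<Rightarrow> real" and g :: "nat \<Rightarrow> real ^ 'd \<Rightarrow> real"
    and A :: "nat \<Rightarrow> real ^ 'm ^ 'n::finite" and B :: "nat \<Rightarrow> real ^ 'd ^ 'n"
    and c :: "real ^ 'n"
    and X :: "nat \<Rightarrow> (real ^ 'm) set" and Y :: "nat \<Rightarrow> (real ^ 'd) set"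
    and \<beta> \<sigma>1 \<sigma>2 \<tau> s :: real
    and x0 :: "nat \<Rightarrow> real ^ 'm" and y0 :: "nat \<Rightarrow> real ^ 'd" and lam0 :: "real ^ 'n"
  assumes "p \<ge> 1" and "q \<ge> 1"
    and "\<And>i. i \<in> {1..p} \<Longrightarrow> closed_convex_fun (coord_space (I i)) (f i)"
    and "\<And>j. j \<in> {1..q} \<Longrightarrow> closed_convex_fun (coord_space (J j)) (g j)"
    and "\<And>i. i \<in> {1..p} \<Longrightarrow> columns_in (I i) (A i) \<and> rank (A i) = card (I i)"
    and "\<And>j. j \<in> {1..q} \<Longrightarrow> columns_in (J j) (B j) \<and> rank (B j) = card (J j)"
    and "\<And>i. i \<in> {1..p} \<Longrightarrow> polyhedron (X i) \<and> X i \<subseteq> coord_space (I i)"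
    and "\<And>j. j \<in> {1..q} \<Longrightarrow> polyhedron (Y j) \<and> Y j \<subseteq> coord_space (J j)"
    and "solution_set p q f g A B c X Y \<noteq> {}"
    and "\<beta> > 0" and "\<sigma>1 > real p - 1" and "\<sigma>2 > real q - 1"
    and "(\<tau>, s) \<in> step_region"
    and "\<And>i. i \<in> {1..p} \<Longrightarrow> x0 i \<in> coord_space (I i)"
    and "\<And>j. j \<in> {1..q} \<Longrightarrow> y0 j \<in> coord_space (J j)"
  shows "\<exists>\<theta>>0. \<forall>x y lam.
    gs_admm p q f g A B c X Y \<beta> \<sigma>1 \<sigma>2 \<tau> s x y lam \<and>
    (\<forall>i\<in>{1..p}. x 0 i = x0 i) \<and> (\<forall>j\<in>{1..q}. y 0 j = y0 j) \<and> lam 0 = lam0 \<longrightarrow>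
    (\<forall>t>0.
      let xt = x (Suc t); yt = y (Suc t); lamt = lam_tilde p q A B c \<beta> x y lam t;
          d1 = dual_res1 p A \<beta> \<sigma>1 xt (x t);
          d1_sum = dual_res1_sum p A \<beta> \<sigma>1 xt (x t);
          d2 = dual_res2 B \<beta> \<sigma>2 \<tau> yt (y t) lamt (lam t)
      in (stacked_norm p q d1 d2)\<^sup>2 \<le> \<theta> / (real t + 1) \<and>
         (stacked_norm p q d1_sum d2)\<^sup>2 \<le> \<theta> / (real t + 1) \<and>
         (norm (residual p q A B c xt yt))\<^sup>2 \<le> \<theta> / (real t + 1) \<and>
         (\<forall>i\<in>{1..p}. transpose (A i) *v lamt - d1 i
            \<in> subdifferential (coord_space (I i)) (f i) (xt i)
              + normal_cone (coord_space (I i)) (X i) (xt i)) \<and>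
         (\<forall>j\<in>{1..q}. transpose (B j) *v lamt - d2 j
            \<in> subdifferential (coord_space (J j)) (g j) (yt j)
              + normal_cone (coord_space (J j)) (Y j) (yt j)))"
proof -
  interpret P: gs_params p q \<beta> \<sigma>1 \<sigma>2 \<tau> s
    using assms(1,2,10-13) by unfold_locales (auto simp: step_region_def)
  have f: "convex_on (coord_space (I i)) (f i)" if "i \<in> {1..p}" for i
    using assms(3)[OF that] by (simp add: closed_convex_fun_def)
  have g: "convex_on (coord_space (J j)) (g j)" if "j \<in> {1..q}" for j
    using assms(4)[OF that] by (simp add: closed_convex_fun_def)
  obtain xs ys where sol: "(xs, ys) \<in> solution_set p q f g A B c X Y"
    using assms(9) by auto
  then have feas: "feasible p q A B c X Y xs ys"
    by (simp add: solution_set_def)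
  obtain ls where
    KKT1: "\<And>i z. i \<in> {1..p} \<Longrightarrow> z \<in> X i \<Longrightarrow> f i (xs i) + ls \<bullet> (A i *v (z - xs i)) \<le> f i z" and
    KKT2: "\<And>j z. j \<in> {1..q} \<Longrightarrow> z \<in> Y j \<Longrightarrow> g j (ys j) + ls \<bullet> (B j *v (z - ys j)) \<le> g j z"
    using kkt_multiplier[OF f g assms(7,8) sol] by blast
  obtain C where C: "C > 0" "\<And>w :: (real ^ 'n) state.
      P.form (P.corr w) (P.corr w) \<le> C * (2 * P.form w (P.corr w) - P.form (P.corr w) (P.corr w))"
    using P.form_corr_le_gap by blast
  obtain C' where C': "C' > 0" "\<And>w :: (real ^ 'n) state.
      P.sq1 w + P.sq2 w + P.sq3 w \<le> C' * P.form (P.corr w) (P.corr w)"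
    using P.sq_le_form_corr by blast
  obtain KA where KA: "KA \<ge> 0" "\<And>i u. i \<in> {1..p} \<Longrightarrow> (norm (transpose (A i) *v u))\<^sup>2 \<le> KA * (norm u)\<^sup>2"
    using uniform_bound_transposes[of p A] by blast
  obtain KB where KB: "KB \<ge> 0" "\<And>j u. j \<in> {1..q} \<Longrightarrow> (norm (transpose (B j) *v u))\<^sup>2 \<le> KB * (norm u)\<^sup>2"
    using uniform_bound_transposes[of q B] by blast
  define ws where "ws = (\<lambda>i. A i *v xs i, \<lambda>j. B j *v ys j, ls)"
  define w0 where "w0 = (\<lambda>i. A i *v x0 i, \<lambda>j. B j *v y0 j, lam0)"
  \<comment> \<open>Bounds \<open>(t + 1) * sq_err t\<close> for every run from the given start:
    \<open>C\<close> enters by the rate of the form, \<open>C'\<close> by passing to plain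
    norms.\<close>
  define R where "R = C' * (C * P.form (w0 - ws) (w0 - ws))"
  define m1 where "m1 = 2 * \<beta>\<^sup>2 * real p + 2 * (\<beta> * (\<sigma>1 + 1))\<^sup>2"
  define m2 where "m2 = 2 * (\<beta> * (1 - \<sigma>1))\<^sup>2 * real p + 2 * \<beta>\<^sup>2"
  define n where "n = real q * (KB * (2 * \<tau>\<^sup>2 + 2 * ((\<sigma>2 + 1) * \<beta>)\<^sup>2))"
  define r where "r = 2 * (inverse \<beta>)\<^sup>2 + 2 * real q"
  \<comment> \<open>One factor above the three that occur below: for \<open>dual_res1\<close>, for
    \<open>dual_res1_sum\<close> and for the primal residual.\<close>
  define \<Theta> where "\<Theta> = real p * (KA * m1) + real p * (KA * m2) + n + r"
  have pos: "m1 \<ge> 0" "m2 \<ge> 0" "n \<ge> 0" "r \<ge> 0" "real p * (KA * m1) \<ge> 0" "real p * (KA * m2) \<ge> 0" "\<Theta> \<ge> 0"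
    using KA(1) KB(1) by (simp_all add: m1_def m2_def n_def r_def \<Theta>_def add_nonneg_nonneg)
  have "R \<ge> 0"
    unfolding R_def using C(1) C'(1) P.form_nonneg[of "w0 - ws"] by (intro mult_nonneg_nonneg) auto
  note pos = pos this
  show ?thesis
  proof (rule exI[of _ "\<Theta> * R + 1"], intro conjI allI impI)
    \<comment> \<open>The summand 1 keeps the constant positive also when \<open>R\<close> is
      0.\<close>
    show "\<Theta> * R + 1 > 0"
      using pos by (simp add: add_nonneg_pos)
    fix x y lam and t :: nat
    assume start: "gs_admm p q f g A B c X Y \<beta> \<sigma>1 \<sigma>2 \<tau> s x y lam \<and>
      (\<forall>i\<in>{1..p}. x 0 i = x0 i) \<and> (\<forall>j\<in>{1..q}. y 0 j = y0 j) \<and> lam 0 = lam0"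
    \<comment> \<open>The run is introduced only after all constants, so these cannot depend on
      it.\<close>
    interpret gs_admm_run p q \<beta> \<sigma>1 \<sigma>2 \<tau> s I J f g A B c X Y x y lam
      using f g assms(5-8) start by unfold_locales (auto intro: polyhedron_imp_convex)
    have "P.form (iter 0 - ws) (iter 0 - ws) = P.form (w0 - ws) (w0 - ws)"
      using start by (intro P.form_cong) (simp_all add: iter_def w0_def)
    then have "(real t + 1) * P.form (P.corr (err t)) (P.corr (err t)) \<le> C * P.form (w0 - ws) (w0 - ws)"
      using rate[OF KKT1 KKT2 feas C, of t] by (simp add: ws_def)
    moreover have "(real t + 1) * sq_err t \<le> C' * ((real t + 1) * P.form (P.corr (err t)) (P.corr (err t)))"
      using mult_left_mono[OF C'(2)[of "err t"], of "real t + 1"]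
      by (simp add: sq_err_def mult.left_commute del: mult_le_cancel_left_pos)
    ultimately have "(real t + 1) * sq_err t \<le> R"
      unfolding R_def using C'(1) by (meson less_imp_le mult_left_mono order_trans)
    then have sq_err: "sq_err t \<le> R / (real t + 1)"
      by (simp add: pos_le_divide_eq mult.commute)
    have bound: "a \<le> (\<Theta> * R + 1) / (real t + 1)" if "a \<le> b * sq_err t" "0 \<le> b" "b \<le> \<Theta>" for a b
    proof -
      have "b * sq_err t \<le> \<Theta> * (R / (real t + 1))"
        using that sq_err pos by (intro mult_mono) (auto simp: sq_err_def)
      also have "\<dots> \<le> (\<Theta> * R + 1) / (real t + 1)"
        by (simp add: divide_right_mono)
      finally show ?thesis
        using that(1) by linarith
    qed
    have "(stacked_norm p q (dual_res1 p A \<beta> \<sigma>1 (x (Suc t)) (x t))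
        (dual_res2 B \<beta> \<sigma>2 \<tau> (y (Suc t)) (y t) (lamt t) (lam t)))\<^sup>2 \<le> (\<Theta> * R + 1) / (real t + 1)"
    proof (rule bound)
      show "(stacked_norm p q (dual_res1 p A \<beta> \<sigma>1 (x (Suc t)) (x t))
        (dual_res2 B \<beta> \<sigma>2 \<tau> (y (Suc t)) (y t) (lamt t) (lam t)))\<^sup>2 \<le> (real p * (KA * m1) + n) * sq_err t"
        unfolding n_def m1_def using dual_res1_eq(1) dual1_bound
        by (intro stacked_bound[OF KA KB]) blast+
    qed (use pos in \<open>auto simp: \<Theta>_def\<close>)
    moreover have "(stacked_norm p q (dual_res1_sum p A \<beta> \<sigma>1 (x (Suc t)) (x t))
        (dual_res2 B \<beta> \<sigma>2 \<tau> (y (Suc t)) (y t) (lamt t) (lam t)))\<^sup>2 \<le> (\<Theta> * R + 1) / (real t + 1)"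
    proof (rule bound)
      show "(stacked_norm p q (dual_res1_sum p A \<beta> \<sigma>1 (x (Suc t)) (x t))
        (dual_res2 B \<beta> \<sigma>2 \<tau> (y (Suc t)) (y t) (lamt t) (lam t)))\<^sup>2 \<le> (real p * (KA * m2) + n) * sq_err t"
        unfolding n_def m2_def using dual_res1_eq(2) dual1_sum_bound
        by (intro stacked_bound[OF KA KB]) blast+
    qed (use pos in \<open>auto simp: \<Theta>_def\<close>)
    moreover have "(norm (res (x (Suc t)) (y (Suc t))))\<^sup>2 \<le> (\<Theta> * R + 1) / (real t + 1)"
      using pos by (intro bound[of _ r]) (auto simp: \<Theta>_def r_def res_bound)
    ultimately show "let xt = x (Suc t); yt = y (Suc t); lamt = lam_tilde p q A B c \<beta> x y lam t;
          d1 = dual_res1 p A \<beta> \<sigma>1 xt (x t);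
          d1_sum = dual_res1_sum p A \<beta> \<sigma>1 xt (x t);
          d2 = dual_res2 B \<beta> \<sigma>2 \<tau> yt (y t) lamt (lam t)
      in (stacked_norm p q d1 d2)\<^sup>2 \<le> (\<Theta> * R + 1) / (real t + 1) \<and>
         (stacked_norm p q d1_sum d2)\<^sup>2 \<le> (\<Theta> * R + 1) / (real t + 1) \<and>
         (norm (residual p q A B c xt yt))\<^sup>2 \<le> (\<Theta> * R + 1) / (real t + 1) \<and>
         (\<forall>i\<in>{1..p}. transpose (A i) *v lamt - d1 i
            \<in> subdifferential (coord_space (I i)) (f i) (xt i)
              + normal_cone (coord_space (I i)) (X i) (xt i)) \<and>
         (\<forall>j\<in>{1..q}. transpose (B j) *v lamt - d2 j
            \<in> subdifferential (coord_space (J j)) (g j) (yt j)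
              + normal_cone (coord_space (J j)) (Y j) (yt j))"
      unfolding Let_def using inclusion1 inclusion2 by blast
  qed
qed

end
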